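(* Let $(R,\mathfrak m)$ be a Noetherian local superring such that $\mathfrak m$ is regular (i.e. $\mathfrak m$ contains a non-zerodivisor of $R$), and let $\Bbbk=R/\mathfrak m=R_{\overline 0}/\mathfrak m_{\overline 0}$ be the residue field. Let $s=\dim_{\Bbbk}\big((\mathfrak m/\mathfrak m^2)_{\overline 1}\big)$. The following conditions are equivalent: (i) $R$ is a discrete valuation superring. (ii) The following two conditions hold: (a) $\overline R$ is a discrete valuation ring; and (b) for any odd elements $z_1,\dots,z_s$ of $\mathfrak m$ whose classes form a $\Bbbk$-basis of $(\mathfrak m/\mathfrak m^2)_{\overline 1}$, the product $z_1z_2\cdots z_s$ is nonzero in $R$. (ii') The following two conditions hold: (a) $\overline R$ is a discrete valuation ring; and (b') for some odd elements $z_1,\dots,z_s$ of $\mathfrak m$ whose classes form a $\Bbbk$-basis of $(\mathfrak m/\mathfrak m^2)_{\overline 1}$, the product $z_1z_2\cdots z_s$ is nonzero in $R$.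
   Context: A superring is a unitary $\mathbb Z_2$-graded ring $R=R_{\overline 0}\oplus R_{\overline 1}$ with $1\ne 0$, always assumed supercommutative: $R_{\overline 0}$ is contained in the center of $R$ and every element of $R_{\overline 1}$ squares to zero. Elements of $R_{\overline 0}$ are even, those of $R_{\overline 1}$ odd, and elements of $R_{\overline 0}\cup R_{\overline 1}$ homogeneous. A superideal is a $\mathbb Z_2$-graded ideal; $R$ is Noetherian if it satisfies the ascending chain condition on superideals. An ideal $\mathfrak p$ is prime (maximal) if $R/\mathfrak p$ is an integral domain (a field); such ideals have the form $\mathfrak p=\mathfrak p_{\overline 0}\oplus R_{\overline 1}$ with $\mathfrak p_{\overline 0}=\mathfrak p\cap R_{\overline 0}$. $R$ is local if it has a unique maximal ideal. $\mathfrak J_R=R\cdot R_{\overline 1}=R_{\overline 1}^2\oplus R_{\overline 1}$ and $\overline R=R/\mathfrak J_R\cong R_{\overline 0}/R_{\overline 1}^2$. A nonzero element $a\in R$ is a zerodivisor if $ar=0$ for some nonzero homogeneous $r\in R$; a non-zerodivisor is a nonzero element which is not a zerodivisor. Krull superdimension: let $R$ be a Noetherian superring with $\mathrm{Kdim}(R_{\overline 0})<\infty$ (usual Krull dimension). Odd elements $a_1,\dots,a_n\in R_{\overline 1}$ form a system of odd parameters of length $n$ if $\mathrm{Kdim}(R_{\overline 0})=\mathrm{Kdim}\big(R_{\overline 0}/\mathrm{Ann}_{R_{\overline 0}}(a_1\cdots a_n)\big)$. The odd Krull superdimension $\mathrm{Ksdim}_{\overline 1}(R)$ is the greatest length of a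 system of odd parameters, the even one is $\mathrm{Ksdim}_{\overline 0}(R)=\mathrm{Kdim}(R_{\overline 0})$, and $\mathrm{Ksdim}(R)=\mathrm{Ksdim}_{\overline 0}(R)\mid\mathrm{Ksdim}_{\overline 1}(R)$. A local Noetherian superring $(R,\mathfrak m)$ with residue field $\Bbbk$ is regular if $\mathrm{Ksdim}(R)=\dim_\Bbbk\big((\mathfrak m/\mathfrak m^2)_{\overline 0}\big)\mid\dim_\Bbbk\big((\mathfrak m/\mathfrak m^2)_{\overline 1}\big)$. A discrete valuation superring is a regular local Noetherian superring of Krull superdimension $1\mid N$ for some non-negative integer $N$. An empty product ($s=0$) is $1$. *)

theory Defs
  imports
    "HOL-Algebra.Algebra"
    "HOL-Library.Extended_Real"
    "Jordan_Normal_Form.Missing_VectorSpace"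
begin

record 'a superring = "'a ring" +
  even_part :: "'a set"
  odd_part :: "'a set"

locale superring = ring R for R :: "('a, 'b) superring_scheme" (structure) +
  assumes one_not_zero: "\<one> \<noteq> \<zero>"
    and even_subgroup: "additive_subgroup (even_part R) R"
    and odd_subgroup: "additive_subgroup (odd_part R) R"
    and direct_sum: "even_part R <+>\<^bsub>R\<^esub> odd_part R = carrier R"
    and direct_inter: "even_part R \<inter> odd_part R = {\<zero>}"
    and even_even: "\<lbrakk>a \<in> even_part R; b \<in> even_part R\<rbrakk> \<Longrightarrow> a \<otimes> b \<in> even_part R"
    and even_odd: "\<lbrakk>a \<in> even_part R; b \<in> odd_part R\<rbrakk> \<Longrightarrow> a \<otimes> b \<in> odd_part R"
    and odd_even: "\<lbrakk>a \<in> odd_part R; b \<in> even_part R\<rbrakk> \<Longrightarrow> a \<otimes> b \<in> odd_part R"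
    and odd_odd: "\<lbrakk>a \<in> odd_part R; b \<in> odd_part R\<rbrakk> \<Longrightarrow> a \<otimes> b \<in> even_part R"
    and even_central: "\<lbrakk>a \<in> even_part R; x \<in> carrier R\<rbrakk> \<Longrightarrow> a \<otimes> x = x \<otimes> a"
    and odd_square: "a \<in> odd_part R \<Longrightarrow> a \<otimes> a = \<zero>"

definition homogeneous :: "('a, 'b) superring_scheme \<Rightarrow> 'a \<Rightarrow> bool" where
  "homogeneous R a \<longleftrightarrow> a \<in> even_part R \<union> odd_part R"

definition superideal :: "'a set \<Rightarrow> ('a, 'b) superring_scheme \<Rightarrow> bool" where
  "superideal I R \<longleftrightarrow>
     ideal I R \<and> I = (I \<inter> even_part R) <+>\<^bsub>R\<^esub> (I \<inter> odd_part R)"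

definition noetherian_superring :: "('a, 'b) superring_scheme \<Rightarrow> bool" where
  "noetherian_superring R \<longleftrightarrow> superring R \<and>
     (\<forall>I :: nat \<Rightarrow> 'a set. (\<forall>n. superideal (I n) R) \<and> (\<forall>n. I n \<subseteq> I (Suc n))
        \<longrightarrow> (\<exists>n. \<forall>k\<ge>n. I k = I n))"

text \<open>
  The library's \<^const>\<open>maximalideal\<close> is defined by maximality among the two-sided ideals; here
  maximality means that the quotient is a (commutative) field.
\<close>
definition super_maximal :: "'a set \<Rightarrow> ('a, 'b) superring_scheme \<Rightarrow> bool" where
  "super_maximal \<mm> R \<longleftrightarrow> ideal \<mm> R \<and> field (R Quot \<mm>)"

definition local_superring :: "('a, 'b) superring_scheme \<Rightarrow> 'a set \<Rightarrow> bool" where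
  "local_superring R \<mm> \<longleftrightarrow>
     superring R \<and> super_maximal \<mm> R \<and> (\<forall>\<nn>. super_maximal \<nn> R \<longrightarrow> \<nn> = \<mm>)"

definition zerodivisor :: "('a, 'b) superring_scheme \<Rightarrow> 'a \<Rightarrow> bool" where
  "zerodivisor R a \<longleftrightarrow> a \<in> carrier R \<and> a \<noteq> \<zero>\<^bsub>R\<^esub> \<and>
     (\<exists>r. homogeneous R r \<and> r \<noteq> \<zero>\<^bsub>R\<^esub> \<and> a \<otimes>\<^bsub>R\<^esub> r = \<zero>\<^bsub>R\<^esub>)"

definition non_zerodivisor :: "('a, 'b) superring_scheme \<Rightarrow> 'a \<Rightarrow> bool" where
  "non_zerodivisor R a \<longleftrightarrow> a \<in> carrier R \<and> a \<noteq> \<zero>\<^bsub>R\<^esub> \<and> \<not> zerodivisor R a"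

definition regular_ideal :: "'a set \<Rightarrow> ('a, 'b) superring_scheme \<Rightarrow> bool" where
  "regular_ideal I R \<longleftrightarrow> ideal I R \<and> (\<exists>a\<in>I. non_zerodivisor R a)"

definition even_ring :: "('a, 'b) superring_scheme \<Rightarrow> ('a, 'b) superring_scheme" where
  "even_ring R = R\<lparr>carrier := even_part R\<rparr>"

text \<open>The superideal \<open>\<JJ>\<^sub>R = R \<cdot> R\<^sub>1\<close>; its quotient \<open>super_reduction R\<close> is the ring \<open>R/\<JJ>\<^sub>R\<close>.\<close>
definition odd_ideal :: "('a, 'b) superring_scheme \<Rightarrow> 'a set" where
  "odd_ideal R = genideal R (odd_part R)"

definition super_reduction :: "('a, 'b) superring_scheme \<Rightarrow> 'a set ring" where
  "super_reduction R = R Quot odd_ideal R"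

definition super_prod :: "('a, 'b) superring_scheme \<Rightarrow> 'a list \<Rightarrow> 'a" where
  "super_prod R as = foldr (\<otimes>\<^bsub>R\<^esub>) as \<one>\<^bsub>R\<^esub>"

text \<open>
  Values are taken in \<^typ>\<open>ereal\<close> so that the zero ring, which has no prime ideals, gets dimension
  \<open>-\<infinity>\<close> and not \<open>0\<close>. Otherwise, over a ring of dimension \<open>0\<close>, odd elements with product
  zero would form a system of odd parameters.
\<close>
definition Kdim :: "('a, 'b) ring_scheme \<Rightarrow> ereal" where
  "Kdim A = (SUP n \<in> {n. \<exists>P :: nat \<Rightarrow> 'a set.
                 (\<forall>i\<le>n. primeideal (P i) A) \<and> (\<forall>i<n. P i \<subset> P (Suc i))}. ereal (real n))"

definition even_annihilator :: "('a, 'b) superring_scheme \<Rightarrow> 'a \<Rightarrow> 'a set" where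
  "even_annihilator R x = {r \<in> even_part R. r \<otimes>\<^bsub>R\<^esub> x = \<zero>\<^bsub>R\<^esub>}"

definition odd_parameters :: "('a, 'b) superring_scheme \<Rightarrow> 'a list \<Rightarrow> bool" where
  "odd_parameters R as \<longleftrightarrow> set as \<subseteq> odd_part R \<and>
     Kdim (even_ring R) = Kdim (even_ring R Quot even_annihilator R (super_prod R as))"

definition Ksdim0 :: "('a, 'b) superring_scheme \<Rightarrow> ereal" where
  "Ksdim0 R = Kdim (even_ring R)"

text \<open>
  For a Noetherian superring with \<open>Kdim (even_ring R) < \<infinity>\<close> the lengths are bounded (a product of
  more odd elements than are needed to generate the odd part vanishes) and the empty list
  qualifies, so the supremum is the greatest length.
\<close>
definition Ksdim1 :: "('a, 'b) superring_scheme \<Rightarrow> enat" where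
  "Ksdim1 R = (SUP as \<in> {as. odd_parameters R as}. enat (length as))"

definition Ksdim :: "('a, 'b) superring_scheme \<Rightarrow> ereal \<times> enat" where
  "Ksdim R = (Ksdim0 R, Ksdim1 R)"

text \<open>
  For \<open>P\<close> the even or the odd part of \<open>R\<close>, \<open>cotangent R \<mm> P\<close> is the homogeneous component of
  \<open>\<mm>/\<mm>\<^sup>2\<close> of that parity, as a vector space over \<open>R/\<mm>\<close>. Its vectors are cosets of \<open>\<mm>\<^sup>2\<close>, its
  scalars cosets of \<open>\<mm>\<close>; for \<open>a \<in> R\<close> and \<open>x \<in> \<mm>\<close> all products of a representative of \<open>a + \<mm>\<close> with one
  of \<open>x + \<mm>\<^sup>2\<close> lie in \<open>ax + \<mm>\<^sup>2\<close>, which is therefore the union that \<^const>\<open>rcoset_mult\<close> forms. The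
  fields \<open>mult\<close> and \<open>one\<close> play no role in a module.
\<close>
definition cotangent ::
    "('a, 'b) superring_scheme \<Rightarrow> 'a set \<Rightarrow> 'a set \<Rightarrow> ('a set, 'a set) module" where
  "cotangent R \<mm> P =
     \<lparr>carrier = (\<lambda>x. ideal_prod R \<mm> \<mm> +>\<^bsub>R\<^esub> x) ` (\<mm> \<inter> P),
      monoid.mult = rcoset_mult R (ideal_prod R \<mm> \<mm>),
      one = ideal_prod R \<mm> \<mm> +>\<^bsub>R\<^esub> \<one>\<^bsub>R\<^esub>,
      ring.zero = ideal_prod R \<mm> \<mm>,
      ring.add = set_add R,
      smult = rcoset_mult R (ideal_prod R \<mm> \<mm>)\<rparr>"

text \<open>
  For a Noetherian \<open>R\<close> these spaces are finite-dimensional, where \<^const>\<open>vectorspace.dim\<close> is the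
  usual dimension.
\<close>
definition cotangent_dim :: "('a, 'b) superring_scheme \<Rightarrow> 'a set \<Rightarrow> 'a set \<Rightarrow> nat" where
  "cotangent_dim R \<mm> P = vectorspace.dim (R Quot \<mm>) (cotangent R \<mm> P)"

definition regular_superring :: "('a, 'b) superring_scheme \<Rightarrow> bool" where
  "regular_superring R \<longleftrightarrow> noetherian_superring R \<and>
     (\<exists>\<mm>. local_superring R \<mm> \<and>
        Ksdim R = (ereal (real (cotangent_dim R \<mm> (even_part R))),
                   enat (cotangent_dim R \<mm> (odd_part R))))"

definition discrete_valuation_superring :: "('a, 'b) superring_scheme \<Rightarrow> bool" where
  "discrete_valuation_superring R \<longleftrightarrow>
     regular_superring R \<and> (\<exists>N :: nat. Ksdim R = (1, enat N))"

text \<open>The classical notion: a local principal ideal domain which is not a field.\<close>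
definition discrete_valuation_ring :: "('a, 'b) ring_scheme \<Rightarrow> bool" where
  "discrete_valuation_ring A \<longleftrightarrow>
     principal_domain A \<and> \<not> field A \<and> (\<exists>!\<mm>. maximalideal \<mm> A)"

definition odd_cotangent_basis ::
    "('a, 'b) superring_scheme \<Rightarrow> 'a set \<Rightarrow> 'a list \<Rightarrow> bool" where
  "odd_cotangent_basis R \<mm> zs \<longleftrightarrow> set zs \<subseteq> \<mm> \<inter> odd_part R \<and>
     (let cs = map (\<lambda>z. ideal_prod R \<mm> \<mm> +>\<^bsub>R\<^esub> z) zs
      in distinct cs \<and>
         vectorspace.basis (R Quot \<mm>) (cotangent R \<mm> (odd_part R)) (set cs))"

end

theory Submission
  imports Defs
begin

text \<open>
  Write \<open>\<nn> = \<mm> \<inter> R\<^sub>0\<close> and let \<open>\<jj> = R\<^sub>1\<^sup>2\<close> be the even part of the ideal generated by the odd elements,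
  so that the reduction of \<open>R\<close> is \<open>R\<^sub>0 / \<jj>\<close>. The even component of \<open>\<mm>/\<mm>\<^sup>2\<close> is the cotangent space
  \<open>\<nn> / (\<nn>\<^sup>2 + \<jj>)\<close> of the reduction, and the odd one is \<open>R\<^sub>1 / \<nn> R\<^sub>1\<close>. By Nakayama's lemma
  (\<open>nakayama\<close>), bases of the latter lift to lists \<open>z\<^sub>1, \<dots>, z\<^sub>s\<close> of generators of the \<open>R\<^sub>0\<close>-module \<open>R\<^sub>1\<close>
  (\<open>odd_cotangent_basis_generates\<close>). Odd elements anticommute and have square zero. Hence products of
  more than \<open>s\<close> odd elements vanish (\<open>super_prod_long\<close>), and if \<open>z = z\<^sub>1 \<dots> z\<^sub>s\<close> vanishes, so do all
  products of \<open>s\<close> odd elements (\<open>super_prod_eq_zero\<close>). So (b) and (b') agree, and the odd Krull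
  superdimension is at most \<open>s\<close> when \<open>R\<^sub>0\<close> has dimension \<open>1\<close>.

  The even side rests on elements \<open>t\<close> with \<open>\<nn> = R\<^sub>0 t + \<jj>\<close>. Elements of \<open>\<jj>\<close> lie in every prime of
  \<open>R\<^sub>0\<close>, and if \<open>t\<close> exists, the only primes can be \<open>\<jj>\<close> and \<open>\<nn>\<close> (\<open>primes_of_uniformizer\<close>). So \<open>R\<^sub>0\<close>
  has dimension \<open>1\<close> exactly if \<open>\<jj>\<close> is a prime different from \<open>\<nn>\<close>, which in turn means that the
  reduction is a discrete valuation ring (\<open>dvr_reductionI\<close>, \<open>dvr_reductionD\<close>). Such a \<open>t\<close> exists if
  the even cotangent space has dimension \<open>1\<close>, and also if the reduction is a discrete valuation ring.

  If \<open>R\<close> is a discrete valuation superring, this gives (a), and a system of \<open>s\<close> odd parameters has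
  a nonzero product because its annihilator is proper; so \<open>z \<noteq> 0\<close>. Conversely, given (a) and
  \<open>z \<noteq> 0\<close>, it remains to see that \<open>z\<^sub>1, \<dots>, z\<^sub>s\<close> are odd parameters, for which it suffices that the
  annihilator \<open>A\<close> of \<open>z\<close> in \<open>R\<^sub>0\<close> lies in \<open>\<jj>\<close>. Now \<open>\<jj> z = 0\<close> since products of \<open>s + 1\<close> odd elements
  vanish, and \<open>\<mm>\<close> contains a regular even element, which is a multiple of \<open>t\<close> modulo \<open>\<jj>\<close>. Therefore
  \<open>t\<close> acts injectively on \<open>R\<^sub>0 z\<close>, so \<open>A \<subseteq> t A + \<jj>\<close>, and Nakayama's lemma gives \<open>A \<subseteq> \<jj>\<close>
  (\<open>even_annihilator_subset_j\<close>).
\<close>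

section \<open>Homogeneous elements\<close>

context superring
begin

lemma even_carrier [simp]: "a \<in> even_part R \<Longrightarrow> a \<in> carrier R"
  using additive_subgroup.a_Hcarr[OF even_subgroup] .

lemma odd_carrier [simp]: "a \<in> odd_part R \<Longrightarrow> a \<in> carrier R"
  using additive_subgroup.a_Hcarr[OF odd_subgroup] .

lemma zero_even [simp]: "\<zero> \<in> even_part R"
  using additive_subgroup.zero_closed[OF even_subgroup] .

lemma zero_odd [simp]: "\<zero> \<in> odd_part R"
  using additive_subgroup.zero_closed[OF odd_subgroup] .

lemma even_add [simp]: "a \<in> even_part R \<Longrightarrow> b \<in> even_part R \<Longrightarrow> a \<oplus> b \<in> even_part R"
  using additive_subgroup.a_closed[OF even_subgroup] .

lemma odd_add [simp]: "a \<in> odd_part R \<Longrightarrow> b \<in> odd_part R \<Longrightarrow> a \<oplus> b \<in> odd_part R"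
  using additive_subgroup.a_closed[OF odd_subgroup] .

lemma additive_subgroup_minus: "additive_subgroup N R \<Longrightarrow> x \<in> N \<Longrightarrow> \<ominus> x \<in> N"
  using additive_subgroup.a_subgroup[of N R] subgroup.m_inv_closed[of N "add_monoid R" x]
  by (simp add: a_inv_def)

lemma even_minus [simp]: "a \<in> even_part R \<Longrightarrow> \<ominus> a \<in> even_part R"
  using additive_subgroup_minus[OF even_subgroup] .

lemma odd_minus [simp]: "a \<in> odd_part R \<Longrightarrow> \<ominus> a \<in> odd_part R"
  using additive_subgroup_minus[OF odd_subgroup] .

lemma additive_subgroup_diff: "additive_subgroup N R \<Longrightarrow> x \<in> N \<Longrightarrow> y \<in> N \<Longrightarrow> x \<ominus> y \<in> N"
  unfolding a_minus_def
  using additive_subgroup.a_closed additive_subgroup_minus by metis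

lemmas parity_closed [simp] = even_even even_odd odd_even odd_odd

lemma set_addI: "x \<in> N \<Longrightarrow> y \<in> N' \<Longrightarrow> x \<oplus> y \<in> N <+>\<^bsub>R\<^esub> N'"
  by (auto simp: set_add_def')

lemma set_addE:
  assumes "z \<in> N <+>\<^bsub>R\<^esub> N'" obtains x y where "x \<in> N" "y \<in> N'" "z = x \<oplus> y"
  using assms by (auto simp: set_add_def')

lemma decompose:
  assumes "x \<in> carrier R"
  obtains a b where "a \<in> even_part R" "b \<in> odd_part R" "x = a \<oplus> b"
  using assms set_addE[of x "even_part R" "odd_part R"] direct_sum by metis

lemma even_odd_zero:
  assumes "a \<in> even_part R" "a \<in> odd_part R" shows "a = \<zero>"
  using assms direct_inter by blast

lemma decompose_unique:
  assumes "a \<in> even_part R" "b \<in> odd_part R" "a' \<in> even_part R" "b' \<in> odd_part R"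
    and eq: "a \<oplus> b = a' \<oplus> b'"
  shows "a = a'" "b = b'"
proof -
  have carr: "a \<in> carrier R" "b \<in> carrier R" "a' \<in> carrier R" "b' \<in> carrier R"
    using assms by auto
  have "a \<ominus> a' = (a \<oplus> b) \<ominus> b \<ominus> a'" using carr by algebra
  also have "\<dots> = b' \<ominus> b" unfolding eq using carr by algebra
  finally have *: "a \<ominus> a' = b' \<ominus> b" .
  moreover have "a \<ominus> a' \<in> even_part R" "b' \<ominus> b \<in> odd_part R"
    using assms by (simp_all add: a_minus_def)
  ultimately have "a \<ominus> a' = \<zero>" "b' \<ominus> b = \<zero>" using even_odd_zero by auto
  then show "a = a'" "b = b'" using carr by auto
qed

text \<open>Multiplying \<open>1 = e + f\<close> by \<open>e\<close> gives \<open>e f = 0\<close> by comparison of odd parts, hence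
\<open>f = f e + f\<^sup>2 = 0\<close>.\<close>

lemma one_even [simp]: "\<one> \<in> even_part R"
proof -
  obtain e f where ef: "e \<in> even_part R" "f \<in> odd_part R" "\<one> = e \<oplus> f"
    using decompose[OF one_closed] .
  have "e \<oplus> \<zero> = e \<otimes> e \<oplus> e \<otimes> f"
    using ef by (metis even_carrier odd_carrier r_distr r_one r_zero)
  then have "\<zero> = e \<otimes> f"
    using decompose_unique[of e \<zero> "e \<otimes> e" "e \<otimes> f"] ef by simp
  moreover have "f = f \<otimes> e \<oplus> f \<otimes> f"
    using ef by (metis even_carrier odd_carrier r_distr r_one)
  ultimately have "f = \<zero>"
    using ef(1,2) even_central[OF ef(1) odd_carrier[OF ef(2)]] odd_square[OF ef(2)] \<open>\<zero> = e \<otimes> f\<close>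
    by (metis l_zero zero_closed)
  then show ?thesis using ef by simp
qed

lemma odd_anticommute:
  assumes "a \<in> odd_part R" "b \<in> odd_part R"
  shows "a \<otimes> b = \<ominus> (b \<otimes> a)"
proof -
  have carr: "a \<in> carrier R" "b \<in> carrier R" using assms by auto
  have "a \<otimes> b \<oplus> b \<otimes> a = (a \<oplus> b) \<otimes> (a \<oplus> b) \<ominus> a \<otimes> a \<ominus> b \<otimes> b"
    using carr by algebra
  also have "\<dots> = \<zero>" using assms odd_square by (simp add: a_minus_def)
  finally show ?thesis using carr by (simp add: minus_equality)
qed

lemma odd_commute_up_to_sign:
  assumes "x \<in> even_part R \<or> x \<in> odd_part R" "m \<in> odd_part R"
  shows "x \<otimes> m = m \<otimes> x \<or> x \<otimes> m = \<ominus> (m \<otimes> x)"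
  using assms even_central odd_anticommute by auto

lemma even_left_commute:
  assumes "a \<in> even_part R" "x \<in> carrier R" "y \<in> carrier R"
  shows "x \<otimes> (a \<otimes> y) = a \<otimes> (x \<otimes> y)"
  using assms even_central[of a x] by (metis even_carrier m_assoc)

lemma even_ring_simps [simp]:
  "carrier (even_ring R) = even_part R" "monoid.mult (even_ring R) = monoid.mult R"
  "monoid.one (even_ring R) = \<one>" "ring.zero (even_ring R) = \<zero>"
  "ring.add (even_ring R) = ring.add R"
  by (simp_all add: even_ring_def)

lemma even_ring_cring: "cring (even_ring R)"
proof (rule cringI)
  show "abelian_group (even_ring R)"
  proof (rule abelian_groupI)
    fix x assume "x \<in> carrier (even_ring R)"
    then show "\<exists>y\<in>carrier (even_ring R). y \<oplus>\<^bsub>even_ring R\<^esub> x = \<zero>\<^bsub>even_ring R\<^esub>"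
      by (auto intro!: bexI[of _ "\<ominus> x"] simp: l_neg)
  qed (auto simp: a_ac)
  show "comm_monoid (even_ring R)"
    by (rule comm_monoidI) (auto simp: m_assoc intro: even_central)
qed (auto simp: l_distr)

end

section \<open>Submodules over the even part\<close>

text \<open>A superring is a module over its commutative even part, and both homogeneous parts are submodules.
Ideals of the even part, spans of odd elements and annihilators are all instances, so that the
chain condition and Nakayama's lemma have to be proved only once.\<close>

definition even_submodule :: "('a, 'b) superring_scheme \<Rightarrow> 'a set \<Rightarrow> bool" where
  "even_submodule R N \<longleftrightarrow> additive_subgroup N R \<and> (\<forall>a\<in>even_part R. \<forall>x\<in>N. a \<otimes>\<^bsub>R\<^esub> x \<in> N)"

context superring
begin

lemma even_submoduleI:
  assumes "N \<subseteq> carrier R" "\<zero> \<in> N" "\<And>x y. x \<in> N \<Longrightarrow> y \<in> N \<Longrightarrow> x \<oplus> y \<in> N"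
    and smult: "\<And>a x. a \<in> even_part R \<Longrightarrow> x \<in> N \<Longrightarrow> a \<otimes> x \<in> N"
  shows "even_submodule R N"
proof -
  have "\<ominus> x \<in> N" if "x \<in> N" for x
  proof -
    have "\<ominus> x = (\<ominus> \<one>) \<otimes> x" using that assms(1) by (auto simp: l_minus)
    then show ?thesis using smult[of "\<ominus> \<one>" x] that by simp
  qed
  then show ?thesis
    unfolding even_submodule_def using assms
    by (auto intro!: additive_subgroupI add.subgroupI simp flip: a_inv_def)
qed

lemma even_submodule_closed:
  assumes "even_submodule R N"
  shows "\<zero> \<in> N" "x \<in> N \<Longrightarrow> y \<in> N \<Longrightarrow> x \<oplus> y \<in> N" "x \<in> N \<Longrightarrow> \<ominus> x \<in> N"
    "x \<in> N \<Longrightarrow> y \<in> N \<Longrightarrow> x \<ominus> y \<in> N"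
    "a \<in> even_part R \<Longrightarrow> x \<in> N \<Longrightarrow> a \<otimes> x \<in> N" "x \<in> N \<Longrightarrow> x \<in> carrier R"
  using assms additive_subgroup.zero_closed[of N R] additive_subgroup.a_closed[of N R x y]
    additive_subgroup_minus[of N x] additive_subgroup_diff[of N x y]
    additive_subgroup.a_Hcarr[of N R x]
  unfolding even_submodule_def by auto

lemma even_submodule_even: "even_submodule R (even_part R)"
  by (rule even_submoduleI) auto

lemma even_submodule_odd: "even_submodule R (odd_part R)"
  by (rule even_submoduleI) auto

lemma even_submodule_Int:
  "even_submodule R N \<Longrightarrow> even_submodule R N' \<Longrightarrow> even_submodule R (N \<inter> N')"
  by (rule even_submoduleI) (auto simp: even_submodule_closed)

lemma ideal_even_submodule: "ideal I R \<Longrightarrow> even_submodule R I"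
  unfolding even_submodule_def using ideal.axioms(1) ideal.I_l_closed by fastforce

lemma even_submodule_adjoin:
  assumes N: "even_submodule R N" and x: "x \<in> carrier R"
  defines "N' \<equiv> {n \<oplus> a \<otimes> x | n a. n \<in> N \<and> a \<in> even_part R}"
  shows "even_submodule R N'" "N \<subseteq> N'" "x \<in> N'"
proof -
  note Nc = even_submodule_closed[OF N]
  have N'I: "n \<oplus> a \<otimes> x \<in> N'" if "n \<in> N" "a \<in> even_part R" for n a
    using that by (auto simp: N'_def)
  show "even_submodule R N'"
  proof (rule even_submoduleI)
    show "N' \<subseteq> carrier R" using x Nc(6) by (auto simp: N'_def)
    show "\<zero> \<in> N'" using N'I[OF Nc(1) zero_even] x by simp
    fix y z assume "y \<in> N'"
    then obtain n a where y: "y = n \<oplus> a \<otimes> x" "n \<in> N" "a \<in> even_part R"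
      unfolding N'_def by auto
    have ca: "n \<in> carrier R" "a \<in> carrier R" using Nc y by auto
    { assume "z \<in> N'"
      then obtain n' a' where z: "z = n' \<oplus> a' \<otimes> x" "n' \<in> N" "a' \<in> even_part R"
        unfolding N'_def by auto
      have "n' \<in> carrier R" "a' \<in> carrier R" using Nc z by auto
      then have "y \<oplus> z = (n \<oplus> n') \<oplus> (a \<oplus> a') \<otimes> x" unfolding y z using x ca by algebra
      moreover have "n \<oplus> n' \<in> N" "a \<oplus> a' \<in> even_part R" using y z Nc by auto
      ultimately show "y \<oplus> z \<in> N'" using N'I by simp }
    { assume z: "z \<in> even_part R"
      have "z \<otimes> y = z \<otimes> n \<oplus> (z \<otimes> a) \<otimes> x" unfolding y using x ca even_carrier[OF z] by algebra
      moreover have "z \<otimes> n \<in> N" "z \<otimes> a \<in> even_part R" using y z Nc by auto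
      ultimately show "z \<otimes> y \<in> N'" using N'I by simp }
  qed
  show "N \<subseteq> N'"
  proof
    fix n assume n: "n \<in> N"
    then show "n \<in> N'" using N'I[OF n zero_even] x Nc(6)[OF n] by simp
  qed
  show "x \<in> N'" using N'I[OF Nc(1) one_even] x by simp
qed

lemma even_submodule_sum:
  assumes N: "even_submodule R N" and N': "even_submodule R N'"
  shows "even_submodule R (N <+>\<^bsub>R\<^esub> N')" "N \<subseteq> N <+>\<^bsub>R\<^esub> N'" "N' \<subseteq> N <+>\<^bsub>R\<^esub> N'"
proof -
  note Nc = even_submodule_closed[OF N] and N'c = even_submodule_closed[OF N']
  show NN: "N \<subseteq> N <+>\<^bsub>R\<^esub> N'"
  proof
    fix x assume x: "x \<in> N"
    show "x \<in> N <+>\<^bsub>R\<^esub> N'" using set_addI[OF x N'c(1)] Nc(6)[OF x] by simp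
  qed
  show "N' \<subseteq> N <+>\<^bsub>R\<^esub> N'"
  proof
    fix x assume x: "x \<in> N'"
    show "x \<in> N <+>\<^bsub>R\<^esub> N'" using set_addI[OF Nc(1) x] N'c(6)[OF x] by simp
  qed
  show "even_submodule R (N <+>\<^bsub>R\<^esub> N')"
  proof (rule even_submoduleI)
    show "N <+>\<^bsub>R\<^esub> N' \<subseteq> carrier R" using Nc(6) N'c(6) by (auto elim!: set_addE)
    show "\<zero> \<in> N <+>\<^bsub>R\<^esub> N'" using NN Nc(1) by blast
  next
    fix x y assume "x \<in> N <+>\<^bsub>R\<^esub> N'" "y \<in> N <+>\<^bsub>R\<^esub> N'"
    then obtain n n' k k' where *: "n \<in> N" "n' \<in> N'" "x = n \<oplus> n'" "k \<in> N" "k' \<in> N'" "y = k \<oplus> k'"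
      by (elim set_addE)
    have "n \<in> carrier R" "n' \<in> carrier R" "k \<in> carrier R" "k' \<in> carrier R"
      using * Nc(6) N'c(6) by blast+
    then have "x \<oplus> y = (n \<oplus> k) \<oplus> (n' \<oplus> k')" unfolding * by (simp add: a_ac)
    then show "x \<oplus> y \<in> N <+>\<^bsub>R\<^esub> N'" using * Nc(2) N'c(2) set_addI by simp
  next
    fix a x assume a: "a \<in> even_part R" and "x \<in> N <+>\<^bsub>R\<^esub> N'"
    then obtain n n' where *: "n \<in> N" "n' \<in> N'" "x = n \<oplus> n'" by (elim set_addE)
    have "n \<in> carrier R" "n' \<in> carrier R" using * Nc(6) N'c(6) by blast+
    then have "a \<otimes> x = a \<otimes> n \<oplus> a \<otimes> n'" unfolding * using a by (simp add: r_distr)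
    then show "a \<otimes> x \<in> N <+>\<^bsub>R\<^esub> N'" using a * Nc(5) N'c(5) set_addI by simp
  qed
qed

text \<open>The smallest superideal containing \<open>N\<close> would involve finite sums of products. The largest one
meeting \<open>P\<close> in \<open>N\<close> is easier to describe: in the other parity take everything that odd elements
multiply into \<open>N\<close>.\<close>

lemma superideal_from_even_submodule:
  assumes PQ: "(P, Q) = (even_part R, odd_part R) \<or> (P, Q) = (odd_part R, even_part R)"
    and N: "even_submodule R N" "N \<subseteq> P"
  defines "N' \<equiv> {y \<in> Q. \<forall>m\<in>odd_part R. m \<otimes> y \<in> N}"
  shows "superideal (N <+>\<^bsub>R\<^esub> N') R" "(N <+>\<^bsub>R\<^esub> N') \<inter> P = N"
proof -
  note Nc = even_submodule_closed[OF N(1)]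
  have P: "even_submodule R P" and Q: "even_submodule R Q"
    using PQ even_submodule_even even_submodule_odd by auto
  have inPQ: "P \<inter> Q = {\<zero>}" using PQ direct_inter by auto
  have oP: "m \<otimes> x \<in> Q" if "m \<in> odd_part R" "x \<in> P" for m x using PQ that by auto
  have oQ: "m \<otimes> x \<in> P" if "m \<in> odd_part R" "x \<in> Q" for m x using PQ that by auto
  have hom: "x \<in> even_part R \<or> x \<in> odd_part R" if "x \<in> P \<or> x \<in> Q" for x using PQ that by auto
  have N': "even_submodule R N'"
  proof (rule even_submoduleI)
    fix a x assume a: "a \<in> even_part R" and x: "x \<in> N'"
    have "m \<otimes> (a \<otimes> x) \<in> N" if m: "m \<in> odd_part R" for m
    proof -
      have "m \<otimes> (a \<otimes> x) = a \<otimes> (m \<otimes> x)"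
        using m a x hom[of x] even_left_commute by (auto simp: N'_def)
      then show ?thesis using Nc(5)[OF a] x m by (simp add: N'_def)
    qed
    then show "a \<otimes> x \<in> N'" using a x even_submodule_closed[OF Q] by (auto simp: N'_def)
  qed (use hom Nc even_submodule_closed[OF Q] in \<open>auto simp: N'_def r_distr\<close>)
  note N'c = even_submodule_closed[OF N']
  have oN: "m \<otimes> x \<in> N'" if "m \<in> odd_part R" "x \<in> N" for m x
  proof -
    have "m' \<otimes> (m \<otimes> x) \<in> N" if "m' \<in> odd_part R" for m'
      using that \<open>m \<in> odd_part R\<close> Nc(5)[of "m' \<otimes> m" x] \<open>x \<in> N\<close> Nc(6)
      by (simp add: m_assoc)
    then show ?thesis using oP that N(2) by (auto simp: N'_def)
  qed
  note sum = even_submodule_sum(1)[OF N(1) N']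
  note NI = even_submodule_sum(2,3)[OF N(1) N']
  note sc = even_submodule_closed[OF sum]
  have odd_l: "m \<otimes> x \<in> N <+>\<^bsub>R\<^esub> N'" if m: "m \<in> odd_part R" and x: "x \<in> N <+>\<^bsub>R\<^esub> N'" for m x
  proof -
    obtain n n' where *: "n \<in> N" "n' \<in> N'" "x = n \<oplus> n'" using x by (elim set_addE)
    have "m \<otimes> n \<in> N'" using oN m * by blast
    moreover have "m \<otimes> n' \<in> N" using m * by (auto simp: N'_def)
    moreover have "m \<otimes> x = m \<otimes> n \<oplus> m \<otimes> n'" using * m Nc N'c by (simp add: r_distr)
    ultimately show ?thesis using sc(2) NI by (metis subsetD)
  qed
  have odd_r: "x \<otimes> m \<in> N <+>\<^bsub>R\<^esub> N'" if m: "m \<in> odd_part R" and x: "x \<in> N <+>\<^bsub>R\<^esub> N'" for m x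
  proof -
    obtain n n' where *: "n \<in> N" "n' \<in> N'" "x = n \<oplus> n'" using x by (elim set_addE)
    have h: "y \<otimes> m \<in> N <+>\<^bsub>R\<^esub> N'" if "y \<in> N <+>\<^bsub>R\<^esub> N'" "y \<in> even_part R \<or> y \<in> odd_part R" for y
      using odd_commute_up_to_sign[OF that(2) m] odd_l[OF m that(1)] sc(3) by auto
    have "n \<otimes> m \<in> N <+>\<^bsub>R\<^esub> N'" using h NI * N hom by blast
    moreover have "n' \<otimes> m \<in> N <+>\<^bsub>R\<^esub> N'" using h NI * hom by (auto simp: N'_def)
    moreover have "x \<otimes> m = n \<otimes> m \<oplus> n' \<otimes> m" using * m Nc N'c by (simp add: l_distr)
    ultimately show ?thesis using sc(2) by simp
  qed
  have ideal: "ideal (N <+>\<^bsub>R\<^esub> N') R"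
  proof (rule idealI)
    show "subgroup (N <+>\<^bsub>R\<^esub> N') (add_monoid R)"
      using sum by (auto simp: even_submodule_def additive_subgroup_def)
    fix x r assume x: "x \<in> N <+>\<^bsub>R\<^esub> N'" and r: "r \<in> carrier R"
    obtain a b where ab: "a \<in> even_part R" "b \<in> odd_part R" "r = a \<oplus> b" using decompose[OF r] .
    have "r \<otimes> x = a \<otimes> x \<oplus> b \<otimes> x" using ab x sc by (simp add: l_distr)
    then show "r \<otimes> x \<in> N <+>\<^bsub>R\<^esub> N'" using ab x sc odd_l by simp
    have "x \<otimes> r = a \<otimes> x \<oplus> x \<otimes> b"
      using ab x sc(6) even_central[OF ab(1) sc(6)[OF x]] by (simp add: r_distr)
    then show "x \<otimes> r \<in> N <+>\<^bsub>R\<^esub> N'" using ab x sc odd_r by simp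
  qed (rule ring_axioms)
  show meet: "(N <+>\<^bsub>R\<^esub> N') \<inter> P = N"
  proof (intro equalityI subsetI)
    fix x assume "x \<in> (N <+>\<^bsub>R\<^esub> N') \<inter> P"
    then obtain n n' where *: "n \<in> N" "n' \<in> N'" "x = n \<oplus> n'" "x \<in> P"
      by (blast elim: set_addE)
    have "n \<in> carrier R" "n' \<in> carrier R" using * Nc(6) N'c(6) by blast+
    then have "x \<ominus> n = n'" unfolding *(3) by algebra
    moreover have "x \<ominus> n \<in> P" using even_submodule_closed(4)[OF P *(4)] *(1) N(2) by blast
    ultimately have "n' \<in> P" by simp
    then have "n' = \<zero>" using * inPQ by (auto simp: N'_def)
    then show "x \<in> N" using * Nc by simp
  qed (use NI N in auto)
  have meet': "(N <+>\<^bsub>R\<^esub> N') \<inter> Q = N'"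
  proof (intro equalityI subsetI)
    fix x assume "x \<in> (N <+>\<^bsub>R\<^esub> N') \<inter> Q"
    then obtain n n' where *: "n \<in> N" "n' \<in> N'" "x = n \<oplus> n'" "x \<in> Q"
      by (blast elim: set_addE)
    have "n \<in> carrier R" "n' \<in> carrier R" using * Nc(6) N'c(6) by blast+
    then have "x \<ominus> n' = n" unfolding *(3) by algebra
    moreover have "x \<ominus> n' \<in> Q"
      using even_submodule_closed(4)[OF Q *(4)] *(2) by (simp add: N'_def)
    ultimately have "n \<in> Q" by simp
    then have "n = \<zero>" using * inPQ N by auto
    then show "x \<in> N'" using * N'c by simp
  qed (use NI in \<open>auto simp: N'_def\<close>)
  have "N <+>\<^bsub>R\<^esub> N' = N' <+>\<^bsub>R\<^esub> N" by (rule set_add_comm) (use Nc(6) N'c(6) in blast)+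
  then show "superideal (N <+>\<^bsub>R\<^esub> N') R"
    unfolding superideal_def using ideal meet meet' PQ by auto
qed

text \<open>The chain condition on superideals passes to submodules of either homogeneous part, because the
superideal of \<open>superideal_from_even_submodule\<close> grows with \<open>N\<close> and determines it.\<close>

lemma even_submodule_maximal:
  assumes noeth: "noetherian_superring R"
    and P: "P = even_part R \<or> P = odd_part R"
    and N0: "N0 \<in> F"
    and F: "\<And>N. N \<in> F \<Longrightarrow> even_submodule R N \<and> N \<subseteq> P"
  shows "\<exists>N\<in>F. \<forall>N'\<in>F. N \<subseteq> N' \<longrightarrow> N' = N"
proof (rule ccontr)
  assume "\<not> ?thesis"
  then have "\<forall>N\<in>F. \<exists>N'\<in>F. N \<subset> N'" by blast
  then obtain g where g: "\<And>N. N \<in> F \<Longrightarrow> g N \<in> F \<and> N \<subset> g N" by metis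
  define S where "S n = (g ^^ n) N0" for n
  have SF: "S n \<in> F" for n by (induct n) (use N0 g in \<open>auto simp: S_def\<close>)
  have SS: "S n \<subset> S (Suc n)" for n using g[OF SF[of n]] by (simp add: S_def)
  obtain Q where PQ: "(P, Q) = (even_part R, odd_part R) \<or> (P, Q) = (odd_part R, even_part R)"
    using P by blast
  define E where "E N = N <+>\<^bsub>R\<^esub> {y \<in> Q. \<forall>m\<in>odd_part R. m \<otimes> y \<in> N}" for N
  have E: "superideal (E (S n)) R" "E (S n) \<inter> P = S n" for n
    unfolding E_def using superideal_from_even_submodule[OF PQ] F[OF SF[of n]] by auto
  have "E (S n) \<subseteq> E (S (Suc n))" for n
    using SS[of n] by (fastforce simp: E_def intro: set_addI elim!: set_addE)
  then have "\<exists>n. \<forall>k\<ge>n. E (S k) = E (S n)"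
    using noeth[unfolded noetherian_superring_def, THEN conjunct2, rule_format, of "\<lambda>n. E (S n)"] E(1)
    by blast
  then obtain n where "\<forall>k\<ge>n. E (S k) = E (S n)" by blast
  then have "E (S (Suc n)) = E (S n)" using le_SucI[of n n] by blast
  then show False using E(2)[of n] E(2)[of "Suc n"] SS[of n] by simp
qed

end

section \<open>Quotients by ideals containing the odd part\<close>

context ring
begin

lemma quotient_hom: "ideal I R \<Longrightarrow> ring_hom_ring R (R Quot I) ((+>) I)"
  using ideal.rcos_ring_hom_ring .

lemma quotient_carrier: "carrier (R Quot I) = (+>) I ` carrier R"
  by (auto simp: FactRing_simps)

lemma quotient_mult:
  "ideal I R \<Longrightarrow> x \<in> carrier R \<Longrightarrow> y \<in> carrier R \<Longrightarrow>
    (I +> x) \<otimes>\<^bsub>R Quot I\<^esub> (I +> y) = I +> (x \<otimes> y)"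
  using ring_hom_ring.homh[OF quotient_hom] ring_hom_mult by metis

lemma quotient_add:
  "ideal I R \<Longrightarrow> x \<in> carrier R \<Longrightarrow> y \<in> carrier R \<Longrightarrow>
    (I +> x) \<oplus>\<^bsub>R Quot I\<^esub> (I +> y) = I +> (x \<oplus> y)"
  using ring_hom_ring.homh[OF quotient_hom] ring_hom_add by metis

lemma quotient_one: "\<one>\<^bsub>R Quot I\<^esub> = I +> \<one>"
  by (simp add: FactRing_def)

lemma coset_eq_iff:
  "ideal I R \<Longrightarrow> x \<in> carrier R \<Longrightarrow> y \<in> carrier R \<Longrightarrow> I +> x = I +> y \<longleftrightarrow> x \<ominus> y \<in> I"
  using quotient_eq_iff_same_a_r_cos by blast

lemma coset_zero_iff:
  assumes "ideal I R" "x \<in> carrier R"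
  shows "I +> x = \<zero>\<^bsub>R Quot I\<^esub> \<longleftrightarrow> x \<in> I"
  using assms a_rcos_zero ideal.rcos_const_imp_mem by (fastforce simp: FactRing_def)

end

context superring
begin

lemma even_part_set_add_Int:
  "K \<subseteq> even_part R \<Longrightarrow> (K <+>\<^bsub>R\<^esub> odd_part R) \<inter> even_part R = K"
  "L \<subseteq> odd_part R \<Longrightarrow> (even_part R <+>\<^bsub>R\<^esub> L) \<inter> odd_part R = L"
proof -
  show "(K <+>\<^bsub>R\<^esub> odd_part R) \<inter> even_part R = K" if K: "K \<subseteq> even_part R"
  proof (intro equalityI subsetI)
    fix x assume "x \<in> (K <+>\<^bsub>R\<^esub> odd_part R) \<inter> even_part R"
    then obtain k m where *: "k \<in> K" "m \<in> odd_part R" "x = k \<oplus> m" "x \<in> even_part R"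
      by (blast elim: set_addE)
    have "x \<oplus> \<zero> = k \<oplus> m" using * by simp
    then have "x = k" using decompose_unique(1)[of x \<zero> k m] * K by auto
    then show "x \<in> K" using * by simp
  next
    fix x assume "x \<in> K"
    then show "x \<in> (K <+>\<^bsub>R\<^esub> odd_part R) \<inter> even_part R"
      using set_addI[of x K \<zero> "odd_part R"] K by (auto simp: subset_eq)
  qed
  show "(even_part R <+>\<^bsub>R\<^esub> L) \<inter> odd_part R = L" if L: "L \<subseteq> odd_part R"
  proof (intro equalityI subsetI)
    fix x assume "x \<in> (even_part R <+>\<^bsub>R\<^esub> L) \<inter> odd_part R"
    then obtain k m where *: "k \<in> even_part R" "m \<in> L" "x = k \<oplus> m" "x \<in> odd_part R"
      by (blast elim: set_addE)
    have "\<zero> \<oplus> x = k \<oplus> m" using * by simp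
    then have "x = m" using decompose_unique(2)[of \<zero> x k m] * L by auto
    then show "x \<in> L" using * by simp
  next
    fix x assume "x \<in> L"
    then show "x \<in> (even_part R <+>\<^bsub>R\<^esub> L) \<inter> odd_part R"
      using set_addI[of \<zero> "even_part R" x L] L by (auto simp: subset_eq)
  qed
qed

text \<open>The ideals of \<open>R\<close> that contain the odd part correspond to the ideals of the even part that contain
all products of two odd elements.\<close>

lemma even_submodule_plus_odd:
  assumes K: "even_submodule R K" "K \<subseteq> even_part R"
    and odd: "\<And>x y. x \<in> odd_part R \<Longrightarrow> y \<in> odd_part R \<Longrightarrow> x \<otimes> y \<in> K"
  shows "ideal (K <+>\<^bsub>R\<^esub> odd_part R) R"
proof (rule idealI)
  note sum = even_submodule_sum[OF K(1) even_submodule_odd]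
  note sc = even_submodule_closed[OF sum(1)]
  show "subgroup (K <+>\<^bsub>R\<^esub> odd_part R) (add_monoid R)"
    using sum(1) by (auto simp: even_submodule_def additive_subgroup_def)
  fix x r assume "x \<in> K <+>\<^bsub>R\<^esub> odd_part R" and r: "r \<in> carrier R"
  then obtain k m where x: "k \<in> K" "m \<in> odd_part R" "x = k \<oplus> m" by (blast elim: set_addE)
  obtain a b where ab: "a \<in> even_part R" "b \<in> odd_part R" "r = a \<oplus> b" using decompose[OF r] .
  have k: "k \<in> even_part R" using x K by blast
  have carr: "k \<in> carrier R" "m \<in> carrier R" "a \<in> carrier R" "b \<in> carrier R"
    using k x ab by auto
  have "r \<otimes> x = (a \<otimes> k \<oplus> b \<otimes> m) \<oplus> (a \<otimes> m \<oplus> b \<otimes> k)"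
    unfolding ab x using carr by algebra
  moreover have "a \<otimes> k \<oplus> b \<otimes> m \<in> K"
    using even_submodule_closed(2)[OF K(1) even_submodule_closed(5)[OF K(1) ab(1) x(1)]] odd[OF ab(2) x(2)] .
  ultimately show "r \<otimes> x \<in> K <+>\<^bsub>R\<^esub> odd_part R" using ab x k by (simp add: set_addI)
  have "x \<otimes> r = (a \<otimes> k \<oplus> m \<otimes> b) \<oplus> (m \<otimes> a \<oplus> k \<otimes> b)"
    unfolding ab x even_central[OF ab(1) carr(1)] using carr by algebra
  moreover have "a \<otimes> k \<oplus> m \<otimes> b \<in> K"
    using even_submodule_closed(2)[OF K(1) even_submodule_closed(5)[OF K(1) ab(1) x(1)]] odd[OF x(2) ab(2)] .
  ultimately show "x \<otimes> r \<in> K <+>\<^bsub>R\<^esub> odd_part R" using ab x k by (simp add: set_addI)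
qed (rule ring_axioms)

text \<open>Products of two odd elements are nilpotent, so every prime ideal of the even part contains them.\<close>

lemma odd_product_square:
  assumes "y \<in> odd_part R" "z \<in> odd_part R"
  shows "(y \<otimes> z) \<otimes> (y \<otimes> z) = \<zero>"
proof -
  have carr: "y \<in> carrier R" "z \<in> carrier R" using assms by auto
  have "(y \<otimes> z) \<otimes> (y \<otimes> z) = y \<otimes> (z \<otimes> y) \<otimes> z" using carr by (simp add: m_assoc)
  also have "\<dots> = y \<otimes> \<ominus> (y \<otimes> z) \<otimes> z" by (simp only: odd_anticommute[OF assms(2,1)])
  also have "\<dots> = \<ominus> ((y \<otimes> y) \<otimes> (z \<otimes> z))" using carr by (simp add: m_assoc r_minus l_minus)
  also have "\<dots> = \<zero>" using odd_square[OF assms(1)] carr by simp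
  finally show ?thesis .
qed

lemma quotient_even_representative:
  assumes I: "ideal I R" "odd_part R \<subseteq> I" and x: "x \<in> carrier R"
  obtains a where "a \<in> even_part R" "I +> x = I +> a"
proof -
  obtain a b where ab: "a \<in> even_part R" "b \<in> odd_part R" "x = a \<oplus> b" using decompose[OF x] .
  have "a \<in> carrier R" "b \<in> carrier R" using ab by auto
  then have "x \<ominus> a = b" unfolding ab(3) by algebra
  then show ?thesis using that[of a] ab I coset_eq_iff[OF I(1) x, of a] by auto
qed

lemma quotient_carrier_even:
  assumes I: "ideal I R" "odd_part R \<subseteq> I"
  shows "carrier (R Quot I) = (+>) I ` even_part R"
proof -
  have "I +> x \<in> (+>) I ` even_part R" if "x \<in> carrier R" for x
    using quotient_even_representative[OF I that] by blast
  then show ?thesis by (auto simp: quotient_carrier)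
qed

lemma quotient_cring:
  assumes I: "ideal I R" "odd_part R \<subseteq> I"
  shows "cring (R Quot I)"
proof -
  interpret Q: ring "R Quot I" using ideal.quotient_is_ring[OF I(1)] .
  show ?thesis
  proof (intro cring.intro comm_monoid.intro comm_monoid_axioms.intro)
    fix x y assume "x \<in> carrier (R Quot I)" "y \<in> carrier (R Quot I)"
    then obtain a b where ab: "x = I +> a" "y = I +> b" "a \<in> even_part R" "b \<in> even_part R"
      using quotient_carrier_even[OF I] by auto
    have "a \<otimes> b = b \<otimes> a" using ab even_central[of a b] by simp
    then show "x \<otimes>\<^bsub>R Quot I\<^esub> y = y \<otimes>\<^bsub>R Quot I\<^esub> x" unfolding ab
      using ab quotient_mult[OF I(1)] by simp
  qed (unfold_locales)
qed

lemma quotient_fieldI: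
  assumes I: "ideal I R" "odd_part R \<subseteq> I" and one: "\<one> \<notin> I"
    and inv: "\<And>a. a \<in> even_part R \<Longrightarrow> a \<notin> I \<Longrightarrow> \<exists>c\<in>even_part R. a \<otimes> c \<ominus> \<one> \<in> I"
  shows "field (R Quot I)"
proof (rule cring.cring_fieldI2[OF quotient_cring[OF I]])
  show "\<zero>\<^bsub>R Quot I\<^esub> \<noteq> \<one>\<^bsub>R Quot I\<^esub>"
    using coset_zero_iff[OF I(1) one_closed] one quotient_one by metis
  fix x assume "x \<in> carrier (R Quot I)" "x \<noteq> \<zero>\<^bsub>R Quot I\<^esub>"
  then obtain a where a: "x = I +> a" "a \<in> even_part R"
    using quotient_carrier_even[OF I] by blast
  have "a \<notin> I" using \<open>x \<noteq> _\<close> coset_zero_iff[OF I(1) even_carrier[OF a(2)]] a(1) by blast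
  obtain c where c: "c \<in> even_part R" "a \<otimes> c \<ominus> \<one> \<in> I" using inv[OF a(2) \<open>a \<notin> I\<close>] by blast
  then have "x \<otimes>\<^bsub>R Quot I\<^esub> (I +> c) = \<one>\<^bsub>R Quot I\<^esub>"
    using a coset_eq_iff[OF I(1)] by (simp add: quotient_mult[OF I(1)] quotient_one)
  moreover have "I +> c \<in> carrier (R Quot I)" using c by (simp add: quotient_carrier)
  ultimately show "\<exists>b\<in>carrier (R Quot I). x \<otimes>\<^bsub>R Quot I\<^esub> b = \<one>\<^bsub>R Quot I\<^esub>" by blast
qed

lemma quotient_domain_one:
  assumes I: "ideal I R" and "domain (R Quot I)"
  shows "\<one> \<notin> I"
  using domain.one_not_zero[OF assms(2)] coset_zero_iff[OF I one_closed] quotient_one by metis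

lemma quotient_domain_prime:
  assumes I: "ideal I R" and dom: "domain (R Quot I)"
    and x: "x \<in> carrier R" and y: "y \<in> carrier R" and "x \<otimes> y \<in> I"
  shows "x \<in> I \<or> y \<in> I"
proof -
  have "(I +> x) \<otimes>\<^bsub>R Quot I\<^esub> (I +> y) = \<zero>\<^bsub>R Quot I\<^esub>"
    using assms coset_zero_iff[OF I, of "x \<otimes> y"] by (simp add: quotient_mult)
  then have "I +> x = \<zero>\<^bsub>R Quot I\<^esub> \<or> I +> y = \<zero>\<^bsub>R Quot I\<^esub>"
    using domain.integral[OF dom] x y by (simp add: quotient_carrier)
  then show ?thesis using coset_zero_iff[OF I] x y by blast
qed

lemma super_maximal_odd:
  assumes "super_maximal I R" shows "odd_part R \<subseteq> I"
proof
  fix x assume x: "x \<in> odd_part R"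
  have I: "ideal I R" "domain (R Quot I)"
    using assms by (auto simp: super_maximal_def field.axioms)
  have "x \<otimes> x \<in> I"
    using odd_square[OF x] additive_subgroup.zero_closed[OF ideal.axioms(1)[OF I(1)]] by simp
  then show "x \<in> I" using quotient_domain_prime[OF I, of x x] x by auto
qed

lemma odd_ideal_ideal: "ideal (odd_ideal R) R"
  unfolding odd_ideal_def by (rule genideal_ideal) auto

lemma odd_part_odd_ideal: "odd_part R \<subseteq> odd_ideal R"
  unfolding odd_ideal_def by (rule genideal_self) auto

lemma odd_ideal_minimal: "ideal I R \<Longrightarrow> odd_part R \<subseteq> I \<Longrightarrow> odd_ideal R \<subseteq> I"
  unfolding odd_ideal_def by (rule genideal_minimal)

lemma odd_mult_odd_ideal:
  "x \<in> odd_part R \<Longrightarrow> y \<in> odd_part R \<Longrightarrow> x \<otimes> y \<in> odd_ideal R \<inter> even_part R"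
  using odd_part_odd_ideal ideal.I_r_closed[OF odd_ideal_ideal] by auto

lemma even_submodule_odd_ideal: "even_submodule R (odd_ideal R \<inter> even_part R)"
  using even_submodule_Int ideal_even_submodule[OF odd_ideal_ideal] even_submodule_even by blast

text \<open>The even part of the ideal generated by the odd elements is \<open>R\<^sub>1\<^sup>2\<close>, described here by minimality
instead of finite sums of products.\<close>

lemma odd_ideal_even_minimal:
  assumes K: "even_submodule R K" "K \<subseteq> even_part R"
    and odd: "\<And>x y. x \<in> odd_part R \<Longrightarrow> y \<in> odd_part R \<Longrightarrow> x \<otimes> y \<in> K"
  shows "odd_ideal R \<inter> even_part R \<subseteq> K"
  using odd_ideal_minimal[OF even_submodule_plus_odd[OF K odd] even_submodule_sum(3)[OF K(1) even_submodule_odd]]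
    even_part_set_add_Int(1)[OF K(2)] by blast

end

section \<open>Noetherian local superrings\<close>

locale noetherian_local_superring = superring R for R :: "('a, 'b) superring_scheme" (structure) +
  fixes \<mm>
  assumes noetherian: "noetherian_superring R" and local_ring: "local_superring R \<mm>"
begin

abbreviation even_max :: "'a set" (\<open>\<nn>\<close>) where "\<nn> \<equiv> \<mm> \<inter> even_part R"

abbreviation even_odd_ideal :: "'a set" (\<open>\<jj>\<close>) where "\<jj> \<equiv> odd_ideal R \<inter> even_part R"

lemma super_maximal_m: "super_maximal \<mm> R"
  using local_ring by (simp add: local_superring_def)

lemma m_ideal: "ideal \<mm> R" and residue_field: "field (R Quot \<mm>)"
  using super_maximal_m by (simp_all add: super_maximal_def)

lemma odd_in_m: "odd_part R \<subseteq> \<mm>"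
  using super_maximal_odd super_maximal_m .

lemma one_notin_m: "\<one> \<notin> \<mm>"
  using quotient_domain_one[OF m_ideal field.axioms(1)[OF residue_field]] .

lemma even_submodule_n: "even_submodule R \<nn>"
  using even_submodule_Int ideal_even_submodule[OF m_ideal] even_submodule_even by blast

lemma n_prime:
  "a \<in> even_part R \<Longrightarrow> b \<in> even_part R \<Longrightarrow> a \<otimes> b \<in> \<mm> \<Longrightarrow> a \<in> \<mm> \<or> b \<in> \<mm>"
  using quotient_domain_prime[OF m_ideal field.axioms(1)[OF residue_field]] by auto

text \<open>Locality is a statement about quotient fields of \<open>R\<close>, and invertibility is needed in the even part.
An even non-unit \<open>x\<close> lies in an ideal \<open>Q\<close> of the even part that is maximal without \<open>1\<close>. Then
\<open>Q\<close> contains the nilpotent products of odd elements, since \<open>1 = q + e\<close> with \<open>e\<^sup>2 = 0\<close> would give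
\<open>(1 + e) q = 1\<close>. So \<open>Q + R\<^sub>1\<close> is an ideal of \<open>R\<close> whose quotient is a field, that is \<open>\<mm>\<close>.\<close>

lemma even_unit:
  assumes x: "x \<in> even_part R" "x \<notin> \<mm>"
  shows "\<exists>y\<in>even_part R. x \<otimes> y = \<one>"
proof (rule ccontr)
  assume no: "\<not> ?thesis"
  define F where "F = {I. even_submodule R I \<and> I \<subseteq> even_part R \<and> \<one> \<notin> I \<and> x \<in> I}"
  define G where "G = {n \<oplus> a \<otimes> x | n a. n \<in> {\<zero>} \<and> a \<in> even_part R}"
  have zero: "even_submodule R {\<zero>}" by (rule even_submoduleI) auto
  have FP: "even_submodule R N \<and> N \<subseteq> even_part R" if "N \<in> F" for N
    using that by (simp add: F_def)
  have "\<one> \<notin> G"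
  proof
    assume "\<one> \<in> G"
    then obtain a where "a \<in> even_part R" "\<one> = a \<otimes> x" unfolding G_def using x by auto
    then show False using no even_central[of a x] x by auto
  qed
  moreover have "G \<subseteq> even_part R" using x by (auto simp: G_def)
  ultimately have "G \<in> F"
    using even_submodule_adjoin(1,3)[OF zero, of x, folded G_def] x by (auto simp: F_def)
  obtain Q where Q: "Q \<in> F" "\<forall>Q'\<in>F. Q \<subseteq> Q' \<longrightarrow> Q' = Q"
    using even_submodule_maximal[OF noetherian disjI1[OF refl] \<open>G \<in> F\<close> FP] by blast
  have Qs: "even_submodule R Q" "Q \<subseteq> even_part R" "\<one> \<notin> Q" "x \<in> Q" using Q by (auto simp: F_def)
  note Qc = even_submodule_closed[OF Qs(1)]
  \<comment> \<open>an element outside \<open>Q\<close> generates the unit ideal together with \<open>Q\<close>, by maximality\<close>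
  have inv: "\<exists>c\<in>even_part R. \<exists>q\<in>Q. \<one> = q \<oplus> c \<otimes> a" if a: "a \<in> even_part R" "a \<notin> Q" for a
  proof (rule ccontr)
    assume no: "\<not> ?thesis"
    define Y where "Y = {n \<oplus> c \<otimes> a | n c. n \<in> Q \<and> c \<in> even_part R}"
    have Y: "even_submodule R Y" "Q \<subseteq> Y" "a \<in> Y"
      using even_submodule_adjoin[OF Qs(1), of a, folded Y_def] a by auto
    have "\<one> \<notin> Y" using no unfolding Y_def by blast
    moreover have "Y \<subseteq> even_part R" using a Qs by (auto simp: Y_def)
    ultimately have "Y \<in> F" using Y Qs by (auto simp: F_def)
    then show False using Q(2) Y a by blast
  qed
  have odd: "y \<otimes> z \<in> Q" if yz: "y \<in> odd_part R" "z \<in> odd_part R" for y z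
  proof (rule ccontr)
    assume "y \<otimes> z \<notin> Q"
    then obtain c q where cq: "c \<in> even_part R" "q \<in> Q" "\<one> = q \<oplus> c \<otimes> (y \<otimes> z)" using inv[OF odd_odd[OF yz]] by blast
    define e where "e = c \<otimes> (y \<otimes> z)"
    have e: "e \<in> even_part R" using cq yz by (simp add: e_def)
    have yz2: "(y \<otimes> z) \<otimes> (y \<otimes> z) = \<zero>" using odd_product_square[OF yz] .
    have "e \<otimes> e = c \<otimes> (c \<otimes> ((y \<otimes> z) \<otimes> (y \<otimes> z)))"
      unfolding e_def using cq yz even_left_commute[of c "y \<otimes> z" "y \<otimes> z"] by (simp add: m_assoc)
    then have "e \<otimes> e = \<zero>" using yz2 cq by simp
    have carr: "q \<in> carrier R" "e \<in> carrier R" using cq(2) Qc(6) e by auto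
    have "(\<one> \<oplus> e) \<otimes> q = (\<one> \<oplus> e) \<otimes> ((q \<oplus> e) \<ominus> e)" using carr by algebra
    also have "q \<oplus> e = \<one>" using cq(3) by (simp add: e_def)
    also have "(\<one> \<oplus> e) \<otimes> (\<one> \<ominus> e) = (\<one> \<oplus> e) \<ominus> (e \<oplus> e \<otimes> e)"
      using carr by (simp add: l_distr r_distr minus_eq r_minus)
    also have "\<dots> = \<one> \<ominus> e \<otimes> e" using carr by algebra
    also have "\<dots> = \<one>" using \<open>e \<otimes> e = \<zero>\<close> by (simp add: minus_eq)
    finally have "(\<one> \<oplus> e) \<otimes> q = \<one>" .
    then show False using Qc(5)[OF even_add[OF one_even e] cq(2)] Qs(3) by simp
  qed
  define I where "I = Q <+>\<^bsub>R\<^esub> odd_part R"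
  have I: "ideal I R" unfolding I_def by (rule even_submodule_plus_odd[OF Qs(1,2) odd])
  have Iodd: "odd_part R \<subseteq> I" "Q \<subseteq> I"
    unfolding I_def using even_submodule_sum[OF Qs(1) even_submodule_odd] by auto
  have IQ: "I \<inter> even_part R = Q" unfolding I_def by (rule even_part_set_add_Int(1)[OF Qs(2)])
  have "field (R Quot I)"
  proof (rule quotient_fieldI[OF I Iodd(1)])
    show "\<one> \<notin> I" using IQ Qs one_even by blast
    fix a assume a: "a \<in> even_part R" "a \<notin> I"
    then have "a \<notin> Q" using Iodd by blast
    then obtain c q where cq: "c \<in> even_part R" "q \<in> Q" "\<one> = q \<oplus> c \<otimes> a" using inv a by blast
    have q: "q \<in> carrier R" using Qc(6) cq by blast
    have "a \<otimes> c \<ominus> \<one> = c \<otimes> a \<ominus> (q \<oplus> c \<otimes> a)"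
      using cq(1) a(1) even_central[OF a(1), of c] by (simp flip: cq(3))
    also have "\<dots> = \<ominus> q" using q even_carrier[OF cq(1)] even_carrier[OF a(1)] by algebra
    finally have "a \<otimes> c \<ominus> \<one> = \<ominus> q" .
    then show "\<exists>c\<in>even_part R. a \<otimes> c \<ominus> \<one> \<in> I" using cq(1) Qc(3)[OF cq(2)] Iodd(2) by (intro bexI[of _ c]) auto
  qed
  then have "I = \<mm>" using local_ring I by (simp add: local_superring_def super_maximal_def)
  then show False using Qs x Iodd by blast
qed

text \<open>Nakayama's lemma: \<open>N \<subseteq> L + \<nn> N\<close> implies \<open>N \<subseteq> L\<close>. The assumption \<open>step\<close> expresses the inclusion
through all submodules \<open>K\<close> that contain \<open>L\<close> and \<open>\<nn> N\<close>, so that the submodule \<open>\<nn> N\<close> of finite sums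
is never formed. If the conclusion failed, take \<open>K \<supseteq> L\<close> maximal with \<open>N \<nsubseteq> K\<close>, and \<open>a x \<notin> K\<close> with
\<open>a \<in> \<nn>\<close> and \<open>x \<in> N\<close>. By maximality \<open>x \<in> N \<subseteq> K + R\<^sub>0 a x\<close>, say \<open>x = k + c a x\<close>; as \<open>1 - c a\<close> is a unit,
\<open>x\<close> lies in \<open>K\<close>, and so does \<open>a x\<close>.\<close>

lemma nakayama:
  assumes P: "P = even_part R \<or> P = odd_part R"
    and N: "N \<subseteq> P" and L: "even_submodule R L" "L \<subseteq> P"
    and step: "\<And>K. even_submodule R K \<Longrightarrow> K \<subseteq> P \<Longrightarrow> L \<subseteq> K \<Longrightarrow>
        (\<And>a x. a \<in> \<nn> \<Longrightarrow> x \<in> N \<Longrightarrow> a \<otimes> x \<in> K) \<Longrightarrow> N \<subseteq> K"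
  shows "N \<subseteq> L"
proof (rule ccontr)
  assume not: "\<not> N \<subseteq> L"
  define F where "F = {K. even_submodule R K \<and> K \<subseteq> P \<and> L \<subseteq> K \<and> \<not> N \<subseteq> K}"
  have Psub: "even_submodule R P" using P even_submodule_even even_submodule_odd by blast
  have FP: "even_submodule R N \<and> N \<subseteq> P" if "N \<in> F" for N
    using that by (simp add: F_def)
  have "L \<in> F" using not L by (auto simp: F_def)
  obtain K where K: "K \<in> F" "\<forall>K'\<in>F. K \<subseteq> K' \<longrightarrow> K' = K"
    using even_submodule_maximal[OF noetherian P \<open>L \<in> F\<close> FP] by blast
  have Ks: "even_submodule R K" "K \<subseteq> P" "L \<subseteq> K" "\<not> N \<subseteq> K" using K by (auto simp: F_def)
  note Kc = even_submodule_closed[OF Ks(1)]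
  obtain a x where ax: "a \<in> \<nn>" "x \<in> N" "a \<otimes> x \<notin> K" using step[OF Ks(1-3)] Ks(4) by blast
  have x: "x \<in> P" using ax N by blast
  have carr: "x \<in> carrier R" "a \<in> carrier R" using x P ax by auto
  define K' where "K' = {n \<oplus> c \<otimes> (a \<otimes> x) | n c. n \<in> K \<and> c \<in> even_part R}"
  have K': "even_submodule R K'" "K \<subseteq> K'" "a \<otimes> x \<in> K'"
    using even_submodule_adjoin[OF Ks(1), of "a \<otimes> x", folded K'_def] carr by auto
  have "K' \<subseteq> P" using Ks ax x even_submodule_closed(2,5)[OF Psub] by (auto simp: K'_def)
  moreover have "K' \<noteq> K" using K' ax by blast
  moreover have "L \<subseteq> K'" using K' Ks by blast
  ultimately have "N \<subseteq> K'" using K(2) K'(1,2) unfolding F_def by blast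
  then obtain k c where kc: "k \<in> K" "c \<in> even_part R" "x = k \<oplus> c \<otimes> (a \<otimes> x)"
    using ax by (auto simp: K'_def)
  have kcar: "k \<in> carrier R" "c \<in> carrier R" using kc Kc(6) by auto
  have "c \<otimes> a \<in> \<mm>" using ideal.I_l_closed[OF m_ideal] ax kcar by blast
  have u: "\<one> \<ominus> c \<otimes> a \<in> even_part R" using kc ax by (simp add: minus_eq)
  moreover have "\<one> \<ominus> c \<otimes> a \<notin> \<mm>"
  proof
    assume "\<one> \<ominus> c \<otimes> a \<in> \<mm>"
    then have "(\<one> \<ominus> c \<otimes> a) \<oplus> c \<otimes> a \<in> \<mm>"
      using \<open>c \<otimes> a \<in> \<mm>\<close> even_submodule_closed(2)[OF ideal_even_submodule[OF m_ideal]] by blast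
    moreover have "(\<one> \<ominus> c \<otimes> a) \<oplus> c \<otimes> a = \<one>" using kcar carr by algebra
    ultimately show False using one_notin_m by simp
  qed
  ultimately obtain v where v: "v \<in> even_part R" "(\<one> \<ominus> c \<otimes> a) \<otimes> v = \<one>"
    using even_unit by blast
  have "(\<one> \<ominus> c \<otimes> a) \<otimes> x = k"
  proof -
    have "(\<one> \<ominus> c \<otimes> a) \<otimes> x = x \<ominus> c \<otimes> (a \<otimes> x)" using kcar carr by algebra
    also have "\<dots> = (k \<oplus> c \<otimes> (a \<otimes> x)) \<ominus> c \<otimes> (a \<otimes> x)" using kc(3) by simp
    also have "\<dots> = k" using kcar carr by algebra
    finally show ?thesis .
  qed
  moreover have "v \<otimes> ((\<one> \<ominus> c \<otimes> a) \<otimes> x) = x"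
    using v u carr even_central[OF v(1) even_carrier[OF u]] by (simp flip: m_assoc)
  ultimately have "x \<in> K" using Kc(5)[OF v(1) kc(1)] by simp
  then show False using Kc(5) ax by blast
qed

abbreviation msq :: "'a set" (\<open>\<mm>\<^sup>2\<close>) where "\<mm>\<^sup>2 \<equiv> ideal_prod R \<mm> \<mm>"

lemma msq_ideal: "ideal \<mm>\<^sup>2 R"
  using ideal_prod_is_ideal[OF m_ideal m_ideal] .

lemma msq_subset: "\<mm>\<^sup>2 \<subseteq> \<mm>"
  using ideal_prod_inter[OF m_ideal m_ideal] by blast

lemma m_decompose:
  assumes "x \<in> \<mm>"
  obtains a b where "a \<in> \<nn>" "b \<in> odd_part R" "x = a \<oplus> b"
proof -
  have x: "x \<in> carrier R" using assms ideal.Icarr[OF m_ideal] by blast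
  obtain a b where ab: "a \<in> even_part R" "b \<in> odd_part R" "x = a \<oplus> b" using decompose[OF x] .
  have "a \<in> carrier R" "b \<in> carrier R" using ab by auto
  then have "x \<ominus> b = a" unfolding ab(3) by algebra
  moreover have "x \<ominus> b \<in> \<mm>"
    using even_submodule_closed(4)[OF ideal_even_submodule[OF m_ideal] assms] ab(2) odd_in_m by blast
  ultimately show ?thesis using that ab by auto
qed

text \<open>The homogeneous components of \<open>\<mm>\<^sup>2\<close> are \<open>\<nn>\<^sup>2 + R\<^sub>1\<^sup>2\<close> and \<open>\<nn> R\<^sub>1\<close>. Nakayama arguments
use the upper bounds, in the form of minimality.\<close>

lemma msq_subsetI:
  assumes K: "even_submodule R K" "K \<subseteq> even_part R" and L: "even_submodule R L" "L \<subseteq> odd_part R"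
    and even: "\<And>a b. a \<in> \<nn> \<Longrightarrow> b \<in> \<nn> \<Longrightarrow> a \<otimes> b \<in> K"
    and odd: "\<And>x y. x \<in> odd_part R \<Longrightarrow> y \<in> odd_part R \<Longrightarrow> x \<otimes> y \<in> K"
    and mixed: "\<And>a y. a \<in> \<nn> \<Longrightarrow> y \<in> odd_part R \<Longrightarrow> a \<otimes> y \<in> L"
  shows "\<mm>\<^sup>2 \<subseteq> K <+>\<^bsub>R\<^esub> L"
proof
  note Kc = even_submodule_closed[OF K(1)] and Lc = even_submodule_closed[OF L(1)]
  fix s assume "s \<in> \<mm>\<^sup>2"
  then show "s \<in> K <+>\<^bsub>R\<^esub> L"
  proof induct
    case (prod x y)
    obtain a b where x: "a \<in> \<nn>" "b \<in> odd_part R" "x = a \<oplus> b" using m_decompose[OF prod(1)] .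
    obtain c d where y: "c \<in> \<nn>" "d \<in> odd_part R" "y = c \<oplus> d" using m_decompose[OF prod(2)] .
    have carr: "a \<in> carrier R" "b \<in> carrier R" "c \<in> carrier R" "d \<in> carrier R" using x y by auto
    have "x \<otimes> y = (a \<otimes> c \<oplus> b \<otimes> d) \<oplus> (a \<otimes> d \<oplus> b \<otimes> c)"
      unfolding x y using carr by algebra
    also have "b \<otimes> c = c \<otimes> b" using even_central[of c b] y carr by simp
    finally show ?case using Kc(2) Lc(2) even odd mixed x y set_addI by simp
  next
    case (sum s1 s2)
    then show ?case using even_submodule_closed(2)[OF even_submodule_sum(1)[OF K(1) L(1)]] by blast
  qed
qed

lemma msq_even_minimal:
  assumes K: "even_submodule R K" "K \<subseteq> even_part R"
    and even: "\<And>a b. a \<in> \<nn> \<Longrightarrow> b \<in> \<nn> \<Longrightarrow> a \<otimes> b \<in> K"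
    and odd: "\<jj> \<subseteq> K"
  shows "\<mm>\<^sup>2 \<inter> even_part R \<subseteq> K"
proof -
  have "\<mm>\<^sup>2 \<subseteq> K <+>\<^bsub>R\<^esub> odd_part R"
    by (rule msq_subsetI[OF K even_submodule_odd])
      (use even odd odd_mult_odd_ideal in \<open>auto\<close>)
  then show ?thesis using even_part_set_add_Int(1)[OF K(2)] by blast
qed

lemma msq_odd_minimal:
  assumes L: "even_submodule R L" "L \<subseteq> odd_part R"
    and mixed: "\<And>a y. a \<in> \<nn> \<Longrightarrow> y \<in> odd_part R \<Longrightarrow> a \<otimes> y \<in> L"
  shows "\<mm>\<^sup>2 \<inter> odd_part R \<subseteq> L"
proof -
  have "\<mm>\<^sup>2 \<subseteq> even_part R <+>\<^bsub>R\<^esub> L"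
    by (rule msq_subsetI[OF even_submodule_even _ L]) (use mixed in auto)
  then show ?thesis using even_part_set_add_Int(2)[OF L(2)] by blast
qed

lemma odd_ideal_in_msq: "\<jj> \<subseteq> \<mm>\<^sup>2"
proof -
  have "\<jj> \<subseteq> \<mm>\<^sup>2 \<inter> even_part R"
  proof (rule odd_ideal_even_minimal)
    show "even_submodule R (\<mm>\<^sup>2 \<inter> even_part R)"
      using even_submodule_Int ideal_even_submodule[OF msq_ideal] even_submodule_even by blast
    fix x y assume "x \<in> odd_part R" "y \<in> odd_part R"
    then show "x \<otimes> y \<in> \<mm>\<^sup>2 \<inter> even_part R"
      using odd_in_m ideal_prod.prod[of x \<mm> y \<mm> R] by auto
  qed auto
  then show ?thesis by blast
qed

lemma odd_ideal_in_m: "odd_ideal R \<subseteq> \<mm>"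
  using odd_ideal_minimal[OF m_ideal odd_in_m] .

end

section \<open>Krull dimension one\<close>

lemma Kdim_eq_1_iff:
  "Kdim A = 1 \<longleftrightarrow> (\<exists>P Q. primeideal P A \<and> primeideal Q A \<and> P \<subset> Q) \<and>
    \<not> (\<exists>P Q S. primeideal P A \<and> primeideal Q A \<and> primeideal S A \<and> P \<subset> Q \<and> Q \<subset> S)"
    (is "_ \<longleftrightarrow> ?one \<and> \<not> ?two")
proof -
  define C where "C = {n. \<exists>P :: nat \<Rightarrow> _ set. (\<forall>i\<le>n. primeideal (P i) A) \<and> (\<forall>i<n. P i \<subset> P (Suc i))}"
  have K: "Kdim A = (SUP n\<in>C. ereal (real n))" by (simp add: Kdim_def C_def)
  have one: "1 \<in> C \<longleftrightarrow> ?one"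
  proof
    assume "1 \<in> C"
    then obtain P where P: "\<forall>i\<le>1. primeideal (P i) A" "\<forall>i<1. P i \<subset> P (Suc i)"
      unfolding C_def by blast
    have "primeideal (P 0) A" "primeideal (P (Suc 0)) A" "P 0 \<subset> P (Suc 0)" using P by auto
    then show ?one by blast
  next
    assume ?one
    then obtain P Q where "primeideal P A" "primeideal Q A" "P \<subset> Q" by blast
    then show "1 \<in> C" unfolding C_def
      by (intro CollectI exI[of _ "\<lambda>i. if i = 0 then P else Q"]) auto
  qed
  have two: "2 \<in> C \<longleftrightarrow> ?two"
  proof
    assume "2 \<in> C"
    then obtain P where P: "\<forall>i\<le>2. primeideal (P i) A" "\<forall>i<2. P i \<subset> P (Suc i)"
      unfolding C_def by blast
    have "primeideal (P 0) A" "primeideal (P 1) A" "primeideal (P 2) A" "P 0 \<subset> P 1" "P 1 \<subset> P 2"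
      using P by (auto simp: numeral_2_eq_2)
    then show ?two by blast
  next
    assume ?two
    then obtain P Q S where "primeideal P A" "primeideal Q A" "primeideal S A" "P \<subset> Q" "Q \<subset> S"
      by blast
    then show "2 \<in> C" unfolding C_def
      by (intro CollectI exI[of _ "\<lambda>i. if i = 0 then P else if i = 1 then Q else S"]) auto
  qed
  have down: "k \<in> C" if "n \<in> C" "k \<le> n" for n k
  proof -
    obtain P where "\<forall>i\<le>n. primeideal (P i) A" "\<forall>i<n. P i \<subset> P (Suc i)"
      using \<open>n \<in> C\<close> unfolding C_def by blast
    then show ?thesis unfolding C_def using \<open>k \<le> n\<close> by (intro CollectI exI[of _ P]) auto
  qed
  show ?thesis
  proof
    assume K1: "Kdim A = 1"
    have "1 \<in> C"
    proof (rule ccontr)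
      assume "1 \<notin> C"
      then have "n = 0" if "n \<in> C" for n using down[OF that, of 1] by (cases n) auto
      then have "(SUP n\<in>C. ereal (real n)) \<le> 0" by (intro SUP_least) auto
      then show False using K1 K by simp
    qed
    moreover have "2 \<notin> C"
    proof
      assume "2 \<in> C"
      then have "ereal (real 2) \<le> Kdim A" unfolding K by (rule SUP_upper)
      then show False using K1 by simp
    qed
    ultimately show "?one \<and> \<not> ?two" using one two by blast
  next
    assume ex: "?one \<and> \<not> ?two"
    have C1: "1 \<in> C" unfolding one using ex by (rule conjunct1)
    have C2: "2 \<notin> C" unfolding two using ex by (rule conjunct2)
    have "n \<le> 1" if "n \<in> C" for n
    proof (rule ccontr)
      assume "\<not> n \<le> 1"
      then have "2 \<le> n" by simp
      then show False using down[OF that] C2 by blast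
    qed
    then have "(SUP n\<in>C. ereal (real n)) \<le> 1" by (intro SUP_least) auto
    moreover have "ereal (real 1) \<le> (SUP n\<in>C. ereal (real n))" using C1 by (rule SUP_upper)
    ultimately show "Kdim A = 1" unfolding K by (intro antisym) (simp_all add: one_ereal_def)
  qed
qed

context cring
begin

lemma primeideal_quotient_image:
  assumes I: "ideal I R" and P: "primeideal P R" "I \<subseteq> P"
  shows "primeideal ((+>) I ` P) (R Quot I)"
proof (rule primeidealI)
  have Pi: "ideal P R" using P(1) primeideal.axioms(1) by blast
  have mem: "x \<in> P" if x: "x \<in> carrier R" "I +> x \<in> (+>) I ` P" for x
  proof -
    obtain p where p: "p \<in> P" "I +> x = I +> p" using x by blast
    have pc: "p \<in> carrier R" using p ideal.Icarr[OF Pi] by blast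
    then have "x \<ominus> p \<in> P" using p(2) coset_eq_iff[OF I x(1) pc] P(2) by blast
    then have "(x \<ominus> p) \<oplus> p \<in> P" using p additive_subgroup.a_closed[OF ideal.axioms(1)[OF Pi]] by blast
    moreover have "(x \<ominus> p) \<oplus> p = x" using x pc by algebra
    ultimately show ?thesis by simp
  qed
  show "ideal ((+>) I ` P) (R Quot I)" by (rule ring_ideal_imp_quot_ideal[OF I Pi])
  show "cring (R Quot I)" using ideal.quotient_is_cring[OF I] is_cring by blast
  show "carrier (R Quot I) \<noteq> (+>) I ` P"
  proof
    assume eq: "carrier (R Quot I) = (+>) I ` P"
    have "x \<in> P" if "x \<in> carrier R" for x
    proof (rule mem[OF that])
      have "I +> x \<in> carrier (R Quot I)" using that by (simp add: quotient_carrier)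
      then show "I +> x \<in> (+>) I ` P" unfolding eq .
    qed
    then have "carrier R \<subseteq> P" by blast
    then show False
      using primeideal.I_notcarr[OF P(1)] additive_subgroup.a_subset[OF ideal.axioms(1)[OF Pi]] by simp
  qed
  fix a b assume ab: "a \<in> carrier (R Quot I)" "b \<in> carrier (R Quot I)"
    "a \<otimes>\<^bsub>R Quot I\<^esub> b \<in> (+>) I ` P"
  then obtain x y where xy: "a = I +> x" "b = I +> y" "x \<in> carrier R" "y \<in> carrier R"
    by (auto simp: quotient_carrier)
  have "x \<otimes> y \<in> P" using mem[of "x \<otimes> y"] ab(3) quotient_mult[OF I] xy by simp
  then show "a \<in> (+>) I ` P \<or> b \<in> (+>) I ` P"
    using primeideal.I_prime[OF P(1)] xy by blast
qed

lemma primeideal_quotient_vimage: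
  assumes I: "ideal I R" and Q: "primeideal Q (R Quot I)"
  shows "primeideal {x \<in> carrier R. I +> x \<in> Q} R"
proof (rule primeidealI)
  have Qi: "ideal Q (R Quot I)" using Q primeideal.axioms(1) by blast
  show "ideal {x \<in> carrier R. I +> x \<in> Q} R"
    using ring_hom_ring.ideal_vimage[OF quotient_hom[OF I] Qi] .
  show "carrier R \<noteq> {x \<in> carrier R. I +> x \<in> Q}"
  proof
    assume eq: "carrier R = {x \<in> carrier R. I +> x \<in> Q}"
    have "I +> x \<in> Q" if "x \<in> carrier R" for x using that eq by blast
    then have "carrier (R Quot I) \<subseteq> Q" by (auto simp: quotient_carrier)
    then show False
      using primeideal.I_notcarr[OF Q] additive_subgroup.a_subset[OF ideal.axioms(1)[OF Qi]] by simp
  qed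
  fix a b assume "a \<in> carrier R" "b \<in> carrier R" "a \<otimes> b \<in> {x \<in> carrier R. I +> x \<in> Q}"
  then show "a \<in> {x \<in> carrier R. I +> x \<in> Q} \<or> b \<in> {x \<in> carrier R. I +> x \<in> Q}"
    using primeideal.I_prime[OF Q, of "I +> a" "I +> b"] quotient_mult[OF I]
    by (auto simp: quotient_carrier)
qed (rule is_cring)

text \<open>An ideal contained in every prime does not change the chains of primes.\<close>

lemma Kdim_quotient_eq_1:
  assumes I: "ideal I R" and sub: "\<And>P. primeideal P R \<Longrightarrow> I \<subseteq> P" and K: "Kdim R = 1"
  shows "Kdim (R Quot I) = 1"
proof -
  let ?p = "\<lambda>Q. {x \<in> carrier R. I +> x \<in> Q}"
  have strict: "?p Q \<subset> ?p Q'" if "primeideal Q (R Quot I)" and Q': "primeideal Q' (R Quot I)" and QQ': "Q \<subset> Q'" for Q Q'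
  proof -
    have "Q' \<subseteq> carrier (R Quot I)"
      using additive_subgroup.a_subset[OF ideal.axioms(1)[OF primeideal.axioms(1)[OF Q']]] .
    moreover obtain q where q: "q \<in> Q'" "q \<notin> Q" using QQ' by blast
    ultimately obtain x where x: "x \<in> carrier R" "q = I +> x" by (auto simp: quotient_carrier)
    have "?p Q \<subseteq> ?p Q'" using QQ' by auto
    moreover have "x \<in> ?p Q'" "x \<notin> ?p Q" using x q by auto
    ultimately show ?thesis by blast
  qed
  have notwo: "\<not> (\<exists>P Q S. primeideal P (R Quot I) \<and> primeideal Q (R Quot I) \<and> primeideal S (R Quot I) \<and> P \<subset> Q \<and> Q \<subset> S)"
  proof
    assume "\<exists>P Q S. primeideal P (R Quot I) \<and> primeideal Q (R Quot I) \<and> primeideal S (R Quot I) \<and> P \<subset> Q \<and> Q \<subset> S"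
    then obtain P Q S where *: "primeideal P (R Quot I)" "primeideal Q (R Quot I)"
      "primeideal S (R Quot I)" "P \<subset> Q" "Q \<subset> S" by blast
    have "\<exists>P Q S. primeideal P R \<and> primeideal Q R \<and> primeideal S R \<and> P \<subset> Q \<and> Q \<subset> S"
      by (intro exI[of _ "?p P"] exI[of _ "?p Q"] exI[of _ "?p S"] conjI
        primeideal_quotient_vimage[OF I] strict *)
    then show False using K unfolding Kdim_eq_1_iff by blast
  qed
  obtain P Q where PQ: "primeideal P R" "primeideal Q R" "P \<subset> Q"
    using K unfolding Kdim_eq_1_iff by blast
  have Pi: "ideal P R" "ideal Q R" using PQ primeideal.axioms(1) by blast+
  obtain x where x: "x \<in> Q" "x \<notin> P" using PQ by blast
  have "I +> x \<notin> (+>) I ` P"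
  proof
    assume "I +> x \<in> (+>) I ` P"
    then obtain p where p: "p \<in> P" "I +> x = I +> p" by blast
    have c: "x \<in> carrier R" "p \<in> carrier R" using ideal.Icarr[OF Pi(1) p(1)] ideal.Icarr[OF Pi(2) x(1)] by auto
    then have "x \<ominus> p \<in> P" using p(2) coset_eq_iff[OF I c] sub[OF PQ(1)] by blast
    then have "(x \<ominus> p) \<oplus> p \<in> P" using p additive_subgroup.a_closed[OF ideal.axioms(1)[OF Pi(1)]] by blast
    moreover have "(x \<ominus> p) \<oplus> p = x" using c by algebra
    ultimately show False using x by simp
  qed
  moreover have "(+>) I ` P \<subseteq> (+>) I ` Q" using PQ(3) by (intro image_mono) simp
  moreover have "I +> x \<in> (+>) I ` Q" using x(1) by (rule imageI)
  ultimately have "(+>) I ` P \<subset> (+>) I ` Q" by (metis psubsetI)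
  then have "\<exists>P Q. primeideal P (R Quot I) \<and> primeideal Q (R Quot I) \<and> P \<subset> Q"
    by (intro exI[of _ "(+>) I ` P"] exI[of _ "(+>) I ` Q"] conjI
      primeideal_quotient_image[OF I PQ(1) sub[OF PQ(1)]]
      primeideal_quotient_image[OF I PQ(2) sub[OF PQ(2)]])
  then show ?thesis using notwo unfolding Kdim_eq_1_iff by blast
qed

text \<open>The zero ring has no primes, hence dimension \<open>-\<infinity>\<close>.\<close>

lemma Kdim_quotient_carrier: "Kdim (R Quot carrier R) \<noteq> 1"
proof
  assume "Kdim (R Quot carrier R) = 1"
  then obtain Q where Q: "primeideal Q (R Quot carrier R)" unfolding Kdim_eq_1_iff by blast
  have "primeideal {x \<in> carrier R. carrier R +> x \<in> Q} R"
    using primeideal_quotient_vimage[OF oneideal Q] .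
  moreover have "carrier R \<in> Q"
    using additive_subgroup.zero_closed[OF ideal.axioms(1)[OF primeideal.axioms(1)[OF Q]]]
    by (simp add: FactRing_def)
  then have "{x \<in> carrier R. carrier R +> x \<in> Q} = carrier R"
    using a_rcos_zero[OF oneideal] by auto
  ultimately show False using primeideal.I_notcarr by metis
qed

end

section \<open>Prime ideals of the even part\<close>

context superring
begin

lemma ideal_even_ring_iff: "ideal I (even_ring R) \<longleftrightarrow> even_submodule R I \<and> I \<subseteq> even_part R"
proof
  assume I: "ideal I (even_ring R)"
  have sub: "I \<subseteq> even_part R" using ideal.Icarr[OF I] by auto
  moreover have "even_submodule R I"
  proof (rule even_submoduleI)
    show "I \<subseteq> carrier R" using sub by auto
    show "\<zero> \<in> I" using additive_subgroup.zero_closed[OF ideal.axioms(1)[OF I]] by simp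
    show "x \<oplus> y \<in> I" if "x \<in> I" "y \<in> I" for x y
      using additive_subgroup.a_closed[OF ideal.axioms(1)[OF I] that] by simp
    show "a \<otimes> x \<in> I" if "a \<in> even_part R" "x \<in> I" for a x
      using ideal.I_l_closed[OF I that(2), of a] that(1) by simp
  qed
  ultimately show "even_submodule R I \<and> I \<subseteq> even_part R" by blast
next
  assume I: "even_submodule R I \<and> I \<subseteq> even_part R"
  interpret A: cring "even_ring R" using even_ring_cring .
  have minus: "\<ominus>\<^bsub>even_ring R\<^esub> x \<in> I" if "x \<in> I" for x
  proof -
    have x: "x \<in> even_part R" using I that by blast
    have "\<ominus>\<^bsub>even_ring R\<^esub> x = \<ominus>\<^bsub>even_ring R\<^esub> \<one>\<^bsub>even_ring R\<^esub> \<otimes>\<^bsub>even_ring R\<^esub> x"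
      using x A.l_minus[of "\<one>" x] by simp
    also have "\<dots> \<in> I"
      using even_submodule_closed(5)[of I, OF _ _ that] I A.a_inv_closed[of \<one>] by simp
    finally show ?thesis .
  qed
  show "ideal I (even_ring R)"
  proof (rule idealI)
    show "subgroup I (add_monoid (even_ring R))"
      using I even_submodule_closed minus
      by (intro A.add.subgroupI) (auto simp flip: a_inv_def)
    fix a x assume "a \<in> I" "x \<in> carrier (even_ring R)"
    then have ax: "a \<in> I" "x \<in> even_part R" "a \<in> carrier R" using I by auto
    then show "x \<otimes>\<^bsub>even_ring R\<^esub> a \<in> I" using I even_submodule_closed(5) by simp
    then show "a \<otimes>\<^bsub>even_ring R\<^esub> x \<in> I" using even_central[OF ax(2,3)] by simp
  qed (rule A.ring_axioms)
qed

lemma primeideal_even_ring_iff: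
  "primeideal P (even_ring R) \<longleftrightarrow> even_submodule R P \<and> P \<subset> even_part R \<and>
    (\<forall>a\<in>even_part R. \<forall>b\<in>even_part R. a \<otimes> b \<in> P \<longrightarrow> a \<in> P \<or> b \<in> P)"
proof
  assume P: "primeideal P (even_ring R)"
  show "even_submodule R P \<and> P \<subset> even_part R \<and>
    (\<forall>a\<in>even_part R. \<forall>b\<in>even_part R. a \<otimes> b \<in> P \<longrightarrow> a \<in> P \<or> b \<in> P)"
    using primeideal.axioms(1)[OF P] primeideal.I_notcarr[OF P] primeideal.I_prime[OF P]
    unfolding ideal_even_ring_iff by auto
next
  assume "even_submodule R P \<and> P \<subset> even_part R \<and>
    (\<forall>a\<in>even_part R. \<forall>b\<in>even_part R. a \<otimes> b \<in> P \<longrightarrow> a \<in> P \<or> b \<in> P)"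
  then show "primeideal P (even_ring R)"
    by (intro primeidealI even_ring_cring) (auto simp: ideal_even_ring_iff)
qed

lemma odd_ideal_subset_prime:
  assumes "primeideal P (even_ring R)" shows "odd_ideal R \<inter> even_part R \<subseteq> P"
proof (rule odd_ideal_even_minimal)
  have P: "even_submodule R P" "P \<subset> even_part R"
    "\<And>a b. a \<in> even_part R \<Longrightarrow> b \<in> even_part R \<Longrightarrow> a \<otimes> b \<in> P \<Longrightarrow> a \<in> P \<or> b \<in> P"
    using assms unfolding primeideal_even_ring_iff by blast+
  show "even_submodule R P" "P \<subseteq> even_part R" using P by auto
  fix x y assume xy: "x \<in> odd_part R" "y \<in> odd_part R"
  then have "(x \<otimes> y) \<otimes> (x \<otimes> y) \<in> P" using odd_product_square even_submodule_closed(1)[OF P(1)] by simp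
  then show "x \<otimes> y \<in> P" using P(3)[of "x \<otimes> y" "x \<otimes> y"] xy by simp
qed

end

context noetherian_local_superring
begin

lemma even_submodule_proper:
  assumes K: "even_submodule R K" "K \<subseteq> even_part R" "\<one> \<notin> K" shows "K \<subseteq> \<nn>"
proof
  fix x assume x: "x \<in> K"
  have "x \<in> \<mm>"
  proof (rule ccontr)
    assume "x \<notin> \<mm>"
    then obtain y where y: "y \<in> even_part R" "x \<otimes> y = \<one>" using even_unit x K(2) by blast
    have "y \<otimes> x \<in> K" using even_submodule_closed(5)[OF K(1) y(1) x] .
    moreover have "y \<otimes> x = \<one>" using even_central[of y x] y x K(2) by auto
    ultimately show False using K(3) by simp
  qed
  then show "x \<in> \<nn>" using x K(2) by blast
qed

lemma primeideal_n: "primeideal \<nn> (even_ring R)"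
  unfolding primeideal_even_ring_iff
  using even_submodule_n n_prime one_notin_m one_even by blast

lemma j_subset_n: "\<jj> \<subseteq> \<nn>"
  using odd_ideal_in_m by blast

lemma primeideal_subset_n:
  assumes "primeideal P (even_ring R)" shows "P \<subseteq> \<nn>"
proof (rule even_submodule_proper)
  have P: "even_submodule R P" "P \<subset> even_part R" using assms unfolding primeideal_even_ring_iff by blast+
  then show "even_submodule R P" "P \<subseteq> even_part R" by auto
  show "\<one> \<notin> P"
  proof
    assume one: "\<one> \<in> P"
    have "x \<in> P" if "x \<in> even_part R" for x using even_submodule_closed(5)[OF P(1) that one] that by simp
    then show False using P(2) by blast
  qed
qed

text \<open>That is, \<open>\<nn> = R\<^sub>0 t + \<jj>\<close>: the image of \<open>t\<close> generates the maximal ideal of \<open>R\<^sub>0 / \<jj>\<close>, which is the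
reduction of \<open>R\<close>.\<close>

definition reduced_uniformizer :: "'a \<Rightarrow> bool" where
  "reduced_uniformizer t \<longleftrightarrow> t \<in> \<nn> \<and> (\<forall>x\<in>\<nn>. \<exists>a\<in>even_part R. \<exists>k\<in>\<jj>. x = a \<otimes> t \<oplus> k)"

text \<open>Nakayama's lemma for \<open>N \<subseteq> t N + \<jj>\<close>. It replaces Krull's intersection theorem: nothing outside
\<open>\<jj>\<close> can be divided by \<open>t\<close> indefinitely.\<close>

lemma divisible_subset_j:
  assumes N: "N \<subseteq> even_part R" and t: "t \<in> \<nn>"
    and div: "\<And>x. x \<in> N \<Longrightarrow> \<exists>y\<in>N. \<exists>k\<in>\<jj>. x = y \<otimes> t \<oplus> k"
  shows "N \<subseteq> \<jj>"
proof (rule nakayama[OF disjI1[OF refl] N even_submodule_odd_ideal])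
  fix K assume K: "even_submodule R K" "\<jj> \<subseteq> K" and step: "\<And>a x. a \<in> \<nn> \<Longrightarrow> x \<in> N \<Longrightarrow> a \<otimes> x \<in> K"
  show "N \<subseteq> K"
  proof
    fix x assume "x \<in> N"
    then obtain y k where y: "y \<in> N" "k \<in> \<jj>" "x = y \<otimes> t \<oplus> k" using div by blast
    have "y \<otimes> t = t \<otimes> y" using even_central[of y t] y(1) N t by auto
    then have "y \<otimes> t \<in> K" using step[OF t y(1)] by simp
    then show "x \<in> K" unfolding y(3) using even_submodule_closed(2)[OF K(1)] y(2) K(2) by blast
  qed
qed auto

lemma uniformizer_multiple:
  assumes t: "reduced_uniformizer t" and K: "even_submodule R K" "\<jj> \<subseteq> K" and x: "x \<in> K" "x \<in> \<nn>"
  shows "\<exists>y\<in>even_part R. \<exists>k\<in>\<jj>. x = y \<otimes> t \<oplus> k \<and> y \<otimes> t \<in> K"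
proof -
  obtain y k where y: "y \<in> even_part R" "k \<in> \<jj>" "x = y \<otimes> t \<oplus> k"
    using t x(2) unfolding reduced_uniformizer_def by blast
  have c: "y \<in> carrier R" "k \<in> carrier R" "t \<in> carrier R"
    using y t by (auto simp: reduced_uniformizer_def)
  have "y \<otimes> t = x \<ominus> k" unfolding y(3) using c by algebra
  then have "y \<otimes> t \<in> K" using even_submodule_closed(4)[OF K(1) x(1)] y(2) K(2) by auto
  then show ?thesis using y by blast
qed

text \<open>A prime that contains \<open>t\<close> contains \<open>\<nn>\<close>. In a prime \<open>P\<close> without \<open>t\<close>, an element \<open>y t + k\<close> with
\<open>k \<in> \<jj> \<subseteq> P\<close> has \<open>y \<in> P\<close>, so that \<open>P \<subseteq> t P + \<jj>\<close>.\<close>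

lemma primes_of_uniformizer:
  assumes t: "reduced_uniformizer t" and P: "primeideal P (even_ring R)"
  shows "P = \<nn> \<or> P = \<jj>"
proof (cases "t \<in> P")
  case True
  have Ps: "even_submodule R P" using P unfolding primeideal_even_ring_iff by blast
  have "\<nn> \<subseteq> P"
  proof
    fix x assume "x \<in> \<nn>"
    then obtain a k where "a \<in> even_part R" "k \<in> \<jj>" "x = a \<otimes> t \<oplus> k"
      using t unfolding reduced_uniformizer_def by blast
    then show "x \<in> P"
      using even_submodule_closed(2,5)[OF Ps] True odd_ideal_subset_prime[OF P] by blast
  qed
  then show ?thesis using primeideal_subset_n[OF P] by blast
next
  case False
  have Ps: "even_submodule R P" "P \<subseteq> even_part R"
    "\<And>a b. a \<in> even_part R \<Longrightarrow> b \<in> even_part R \<Longrightarrow> a \<otimes> b \<in> P \<Longrightarrow> a \<in> P \<or> b \<in> P"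
    using P unfolding primeideal_even_ring_iff by blast+
  have tn: "t \<in> \<nn>" using t by (simp add: reduced_uniformizer_def)
  have "P \<subseteq> \<jj>"
  proof (rule divisible_subset_j[OF Ps(2) tn])
    fix x assume x: "x \<in> P"
    then obtain y k where y: "y \<in> even_part R" "k \<in> \<jj>" "x = y \<otimes> t \<oplus> k" "y \<otimes> t \<in> P"
      using uniformizer_multiple[OF t Ps(1) odd_ideal_subset_prime[OF P]] primeideal_subset_n[OF P] by blast
    have "y \<in> P" using Ps(3)[OF y(1) _ y(4)] tn False by blast
    then show "\<exists>y\<in>P. \<exists>k\<in>\<jj>. x = y \<otimes> t \<oplus> k" using y by blast
  qed
  then show ?thesis using odd_ideal_subset_prime[OF P] by blast
qed

lemma Kdim_even_ring_eq_1_iff: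
  assumes t: "reduced_uniformizer t"
  shows "Kdim (even_ring R) = 1 \<longleftrightarrow> primeideal \<jj> (even_ring R) \<and> \<jj> \<noteq> \<nn>"
proof -
  note two = primes_of_uniformizer[OF t]
  have "\<not> (\<exists>P Q S. primeideal P (even_ring R) \<and> primeideal Q (even_ring R) \<and> primeideal S (even_ring R)
      \<and> P \<subset> Q \<and> Q \<subset> S)"
    using two by (metis psubset_trans order_less_irrefl)
  moreover have "(\<exists>P Q. primeideal P (even_ring R) \<and> primeideal Q (even_ring R) \<and> P \<subset> Q) \<longleftrightarrow>
      primeideal \<jj> (even_ring R) \<and> \<jj> \<noteq> \<nn>"
  proof
    assume "\<exists>P Q. primeideal P (even_ring R) \<and> primeideal Q (even_ring R) \<and> P \<subset> Q"
    then obtain P Q where PQ: "primeideal P (even_ring R)" "primeideal Q (even_ring R)" "P \<subset> Q" by blast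
    then show "primeideal \<jj> (even_ring R) \<and> \<jj> \<noteq> \<nn>" using two[OF PQ(1)] two[OF PQ(2)] j_subset_n PQ
      by (metis psubset_subset_trans order_less_irrefl)
  next
    assume "primeideal \<jj> (even_ring R) \<and> \<jj> \<noteq> \<nn>"
    then show "\<exists>P Q. primeideal P (even_ring R) \<and> primeideal Q (even_ring R) \<and> P \<subset> Q"
      using primeideal_n j_subset_n by (metis psubsetI)
  qed
  ultimately show ?thesis unfolding Kdim_eq_1_iff by blast
qed

end

section \<open>Products of odd elements\<close>

definition even_span :: "('a, 'b) superring_scheme \<Rightarrow> 'a set \<Rightarrow> 'a set" where
  "even_span R S = \<Inter> {K. even_submodule R K \<and> S \<subseteq> K}"

context superring
begin

lemma even_submodule_carrier: "even_submodule R (carrier R)"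
  by (rule even_submoduleI) auto

lemma even_span_superset: "S \<subseteq> even_span R S"
  by (auto simp: even_span_def)

lemma even_span_minimal: "even_submodule R K \<Longrightarrow> S \<subseteq> K \<Longrightarrow> even_span R S \<subseteq> K"
  by (auto simp: even_span_def)

lemma even_submodule_span:
  assumes "S \<subseteq> carrier R" shows "even_submodule R (even_span R S)"
proof (rule even_submoduleI)
  show "even_span R S \<subseteq> carrier R" using even_span_minimal[OF even_submodule_carrier assms] .
qed (auto simp: even_span_def even_submodule_closed)

lemma super_prod_simps [simp]:
  "super_prod R [] = \<one>" "super_prod R (a # as) = a \<otimes> super_prod R as"
  by (simp_all add: super_prod_def)

lemma super_prod_homogeneous:
  assumes "set as \<subseteq> odd_part R"
  shows "super_prod R as \<in> even_part R \<or> super_prod R as \<in> odd_part R"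
  using assms by (induct as) auto

lemma super_prod_closed [simp]:
  "set as \<subseteq> odd_part R \<Longrightarrow> super_prod R as \<in> carrier R"
  using super_prod_homogeneous[of as] by auto

lemma super_prod_move_front:
  assumes "set w \<subseteq> odd_part R" "a \<in> set w"
  shows "super_prod R w = a \<otimes> super_prod R (remove1 a w) \<or>
    super_prod R w = \<ominus> (a \<otimes> super_prod R (remove1 a w))"
  using assms
proof (induct w)
  case (Cons b w)
  show ?case
  proof (cases "a = b")
    case False
    then have a: "a \<in> set w" "set w \<subseteq> odd_part R" "b \<in> odd_part R" "a \<in> odd_part R" using Cons by auto
    let ?p = "super_prod R (remove1 a w)"
    have sub: "set (remove1 a w) \<subseteq> odd_part R" using a(2) set_remove1_subset[of a w] by blast
    have carr: "a \<in> carrier R" "b \<in> carrier R" "?p \<in> carrier R" using a sub by auto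
    have "b \<otimes> (a \<otimes> ?p) = (b \<otimes> a) \<otimes> ?p" using carr by (simp add: m_assoc)
    also have "\<dots> = \<ominus> (a \<otimes> b) \<otimes> ?p" by (simp only: odd_anticommute[OF a(3,4)])
    also have "\<dots> = \<ominus> (a \<otimes> (b \<otimes> ?p))" using carr by (simp add: l_minus m_assoc)
    finally have swap: "b \<otimes> (a \<otimes> ?p) = \<ominus> (a \<otimes> (b \<otimes> ?p))" .
    have "super_prod R w = a \<otimes> ?p \<or> super_prod R w = \<ominus> (a \<otimes> ?p)" using Cons a by blast
    then show ?thesis using False carr swap by (auto simp: r_minus)
  qed simp
qed simp

lemma super_prod_permutation:
  assumes "set v \<subseteq> odd_part R" "mset w = mset v"
  shows "super_prod R w = super_prod R v \<or> super_prod R w = \<ominus> super_prod R v"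
  using assms
proof (induct v arbitrary: w)
  case (Cons a v)
  have a: "a \<in> set w" using Cons(3) by (metis list.set_intros(1) mset_eq_setD)
  have w: "set w \<subseteq> odd_part R" using Cons(2,3) by (metis mset_eq_setD)
  have "mset (remove1 a w) = mset v" using Cons(3) by simp
  then have "super_prod R (remove1 a w) = super_prod R v \<or> super_prod R (remove1 a w) = \<ominus> super_prod R v"
    using Cons(1)[of "remove1 a w"] Cons(2) by simp
  moreover have "a \<in> carrier R" "super_prod R v \<in> carrier R" using Cons(2) by auto
  ultimately show ?case using super_prod_move_front[OF w a] by (auto simp: r_minus)
qed simp

lemma super_prod_repeat:
  assumes "set w \<subseteq> odd_part R" "\<not> distinct w"
  shows "super_prod R w = \<zero>"
  using assms
proof (induct w)
  case (Cons a w)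
  have a: "a \<in> odd_part R" "set w \<subseteq> odd_part R" "a \<in> carrier R" using Cons by auto
  show ?case
  proof (cases "distinct w")
    case True
    then have aw: "a \<in> set w" using Cons by simp
    let ?p = "super_prod R (remove1 a w)"
    have "set (remove1 a w) \<subseteq> odd_part R" using a(2) set_remove1_subset[of a w] by blast
    then have p: "?p \<in> carrier R" by simp
    have "a \<otimes> (a \<otimes> ?p) = (a \<otimes> a) \<otimes> ?p" using a p by (simp add: m_assoc)
    also have "\<dots> = \<zero>" using odd_square[OF a(1)] p by simp
    finally show ?thesis using super_prod_move_front[OF a(2) aw] a p by (auto simp: r_minus)
  next
    case False
    then show ?thesis using Cons a by simp
  qed
qed simp

text \<open>Multilinearity: if the odd part is spanned by \<open>Z\<close>, a product of odd elements is a combination of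
words in \<open>Z\<close> of the same length. The induction replaces the last factors first, with \<open>K\<close>
generalised to its transporters \<open>{y. z y \<in> K}\<close>, and then the first factor.\<close>

lemma super_prod_in_submodule:
  assumes Z: "Z \<subseteq> odd_part R" "odd_part R \<subseteq> even_span R Z"
    and K: "even_submodule R K"
    and words: "\<And>w. set w \<subseteq> Z \<Longrightarrow> length w = n \<Longrightarrow> super_prod R w \<in> K"
    and as: "set as \<subseteq> odd_part R" "length as = n"
  shows "super_prod R as \<in> K"
  using K words as
proof (induct n arbitrary: K as)
  case 0
  then show ?case using "0.prems"(2)[of "[]"] by simp
next
  case (Suc n)
  obtain a as' where as: "as = a # as'" "set as' \<subseteq> odd_part R" "a \<in> odd_part R" "length as' = n"
    using Suc.prems(3,4) by (cases as) auto
  let ?p = "super_prod R as'"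
  have p: "?p \<in> carrier R" using as by simp
  note Kc = even_submodule_closed[OF Suc.prems(1)]
  have gen: "z \<otimes> ?p \<in> K" if z: "z \<in> Z" for z
  proof -
    have zc: "z \<in> carrier R" using z Z by auto
    have "even_submodule R {y \<in> carrier R. z \<otimes> y \<in> K}"
    proof (rule even_submoduleI)
      fix a x assume "a \<in> even_part R" "x \<in> {y \<in> carrier R. z \<otimes> y \<in> K}"
      then show "a \<otimes> x \<in> {y \<in> carrier R. z \<otimes> y \<in> K}"
        using zc Kc(5) even_left_commute[of a z x] by simp
    qed (use zc Kc(1,2) in \<open>auto simp: r_distr\<close>)
    moreover have "super_prod R w \<in> {y \<in> carrier R. z \<otimes> y \<in> K}" if w: "set w \<subseteq> Z" "length w = n" for w
      using Suc.prems(2)[of "z # w"] w z Z(1) super_prod_closed[of w] by auto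
    ultimately have "?p \<in> {y \<in> carrier R. z \<otimes> y \<in> K}" using as Suc.hyps by blast
    then show ?thesis by simp
  qed
  have "even_submodule R {x \<in> carrier R. x \<otimes> ?p \<in> K}"
    by (rule even_submoduleI) (use p Kc(1,2,5) in \<open>auto simp: l_distr m_assoc\<close>)
  moreover have "Z \<subseteq> {x \<in> carrier R. x \<otimes> ?p \<in> K}" using gen Z(1) by auto
  ultimately have "a \<in> {x \<in> carrier R. x \<otimes> ?p \<in> K}"
    using even_span_minimal[of _ Z] Z(2) as(3) by blast
  then show ?case using as by simp
qed

lemma even_submodule_zero: "even_submodule R {\<zero>}"
  by (rule even_submoduleI) auto

text \<open>A word that is longer than the list of generators repeats a letter.\<close>

lemma super_prod_long:
  assumes Z: "set zs \<subseteq> odd_part R" "odd_part R \<subseteq> even_span R (set zs)"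
    and as: "set as \<subseteq> odd_part R" "length zs < length as"
  shows "super_prod R as = \<zero>"
proof -
  have "super_prod R w \<in> {\<zero>}" if w: "set w \<subseteq> set zs" "length w = length as" for w
  proof -
    have "card (set w) \<le> length zs"
      using card_mono[OF finite_set w(1)] card_length[of zs] by linarith
    then have "\<not> distinct w" using distinct_card[of w] w as by auto
    then show ?thesis using super_prod_repeat[of w] w Z(1) by auto
  qed
  then have "super_prod R as \<in> {\<zero>}"
    by (intro super_prod_in_submodule[OF Z even_submodule_zero _ as(1) refl]) auto
  then show ?thesis by simp
qed

text \<open>A word of length \<open>length zs\<close> either repeats a letter or is a permutation of \<open>zs\<close>, so that its product
is a multiple of the product of \<open>zs\<close>. This makes the nonvanishing of the latter independent of the
choice of the generators.\<close>

lemma super_prod_eq_zero: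
  assumes Z: "set zs \<subseteq> odd_part R" "odd_part R \<subseteq> even_span R (set zs)"
    and as: "set as \<subseteq> odd_part R" "length as = length zs" and zero: "super_prod R zs = \<zero>"
  shows "super_prod R as = \<zero>"
proof -
  have "super_prod R w \<in> {\<zero>}" if w: "set w \<subseteq> set zs" "length w = length as" for w
  proof (cases "distinct w")
    case True
    have c: "card (set w) = length zs" using distinct_card[OF True] w as by simp
    have le: "card (set w) \<le> card (set zs)" by (rule card_mono[OF finite_set w(1)])
    have "set w = set zs"
      using card_subset_eq[OF finite_set w(1)] le c card_length[of zs] by linarith
    moreover have "distinct zs" using card_distinct[of zs] le c card_length[of zs] by linarith
    ultimately have "mset w = mset zs" using True set_eq_iff_mset_eq_distinct by blast
    then show ?thesis using super_prod_permutation[OF Z(1)] zero by auto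
  next
    case False
    then show ?thesis using super_prod_repeat[of w] w Z(1) by auto
  qed
  then have "super_prod R as \<in> {\<zero>}"
    by (intro super_prod_in_submodule[OF Z even_submodule_zero _ as(1) refl]) auto
  then show ?thesis by simp
qed

lemma odd_ideal_annihilates_prod:
  assumes Z: "set zs \<subseteq> odd_part R" "odd_part R \<subseteq> even_span R (set zs)"
    and k: "k \<in> odd_ideal R \<inter> even_part R"
  shows "k \<otimes> super_prod R zs = \<zero>"
proof -
  let ?z = "super_prod R zs"
  have z: "?z \<in> carrier R" using Z by simp
  have "odd_ideal R \<inter> even_part R \<subseteq> {k \<in> even_part R. k \<otimes> ?z = \<zero>}"
  proof (rule odd_ideal_even_minimal)
    show "even_submodule R {k \<in> even_part R. k \<otimes> ?z = \<zero>}"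
      by (rule even_submoduleI) (use z in \<open>auto simp: l_distr m_assoc\<close>)
    fix x y assume xy: "x \<in> odd_part R" "y \<in> odd_part R"
    have "super_prod R (y # zs) = \<zero>" using super_prod_long[OF Z, of "y # zs"] xy Z by simp
    then show "x \<otimes> y \<in> {k \<in> even_part R. k \<otimes> ?z = \<zero>}" using xy z by (simp add: m_assoc)
  qed auto
  then show ?thesis using k by blast
qed

end

section \<open>When the reduction is a discrete valuation ring\<close>

context noetherian_local_superring
begin

lemmas j_closed = even_submodule_closed(2,5,6,1)[OF even_submodule_odd_ideal]

text \<open>Take a maximal ideal \<open>I \<supseteq> \<jj>\<close> among those that are not principal modulo \<open>\<jj>\<close>, and let
\<open>I' = {y. y t \<in> I} \<supseteq> I\<close>. Since \<open>I \<subseteq> \<nn>\<close>, we have \<open>I = t I' + \<jj>\<close>. If \<open>I' = I\<close>, then \<open>I = \<jj>\<close> by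
Nakayama; otherwise \<open>I'\<close> has a generator \<open>g\<close> by maximality, and \<open>g t\<close> generates \<open>I\<close>.\<close>

lemma even_submodule_principal_mod_j:
  assumes t: "reduced_uniformizer t"
    and N: "even_submodule R N" "N \<subseteq> even_part R" "\<jj> \<subseteq> N"
  shows "\<exists>g\<in>N. \<forall>y\<in>N. \<exists>a\<in>even_part R. \<exists>k\<in>\<jj>. y = a \<otimes> g \<oplus> k"
proof -
  define gen where "gen N \<longleftrightarrow> (\<exists>g\<in>N. \<forall>y\<in>N. \<exists>a\<in>even_part R. \<exists>k\<in>\<jj>. y = a \<otimes> g \<oplus> k)" for N
  define F where "F = {N. even_submodule R N \<and> N \<subseteq> even_part R \<and> \<jj> \<subseteq> N \<and> \<not> gen N}"
  have FP: "even_submodule R N \<and> N \<subseteq> even_part R" if "N \<in> F" for N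
    using that by (simp add: F_def)
  have tn: "t \<in> \<nn>" using t by (simp add: reduced_uniformizer_def)
  have te: "t \<in> even_part R" "t \<in> carrier R" using tn by auto
  have False if N: "N \<in> F" for N
  proof -
    obtain I where I: "I \<in> F" "\<forall>I'\<in>F. I \<subseteq> I' \<longrightarrow> I' = I"
      using even_submodule_maximal[OF noetherian disjI1[OF refl] N FP] by blast
    have Is: "even_submodule R I" "I \<subseteq> even_part R" "\<jj> \<subseteq> I" "\<not> gen I"
      using I(1) by (simp_all add: F_def)
    note Ic = even_submodule_closed[OF Is(1)]
    have "\<one> \<notin> I"
    proof
      assume one: "\<one> \<in> I"
      have "\<exists>a\<in>even_part R. \<exists>k\<in>\<jj>. y = a \<otimes> \<one> \<oplus> k" if "y \<in> I" for y
        by (rule bexI[of _ y], rule bexI[of _ \<zero>]) (use that Is(2) j_closed(4) in auto)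
      then show False using Is(4) one unfolding gen_def by blast
    qed
    then have In: "I \<subseteq> \<nn>" using even_submodule_proper[OF Is(1,2)] by blast
    define I' where "I' = {y \<in> even_part R. y \<otimes> t \<in> I}"
    have I': "even_submodule R I'"
      by (rule even_submoduleI) (use te Ic(1,2,5) in \<open>auto simp: I'_def l_distr m_assoc\<close>)
    have II': "I \<subseteq> I'"
    proof
      fix y assume y: "y \<in> I"
      have "y \<otimes> t = t \<otimes> y" using even_central[of y t] te y Is(2) by auto
      then show "y \<in> I'" using Ic(5)[OF te(1) y] y Is(2) by (auto simp: I'_def)
    qed
    have div: "\<exists>y\<in>I'. \<exists>k\<in>\<jj>. x = y \<otimes> t \<oplus> k" if x: "x \<in> I" for x
      using uniformizer_multiple[OF t Is(1,3) x] In x by (auto simp: I'_def)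
    have "I' \<noteq> I"
    proof
      assume "I' = I"
      then have "I \<subseteq> \<jj>" using divisible_subset_j[OF Is(2) tn] div by blast
      have "\<exists>a\<in>even_part R. \<exists>k\<in>\<jj>. y = a \<otimes> \<zero> \<oplus> k" if "y \<in> I" for y
        by (rule bexI[of _ \<zero>], rule bexI[of _ y]) (use that \<open>I \<subseteq> \<jj>\<close> Ic(6) in auto)
      then show False using Is(4) Ic(1) unfolding gen_def by blast
    qed
    then have "I' \<notin> F" using I(2) II' by blast
    then have "gen I'" using I' II' Is(3) by (auto simp: F_def I'_def)
    then obtain g where g: "g \<in> I'" "\<forall>y\<in>I'. \<exists>a\<in>even_part R. \<exists>k\<in>\<jj>. y = a \<otimes> g \<oplus> k"
      unfolding gen_def by blast
    have gt: "g \<otimes> t \<in> I" "g \<in> carrier R" using g(1) by (auto simp: I'_def)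
    have "\<exists>a\<in>even_part R. \<exists>k\<in>\<jj>. x = a \<otimes> (g \<otimes> t) \<oplus> k" if x: "x \<in> I" for x
    proof -
      obtain y k where y: "y \<in> I'" "k \<in> \<jj>" "x = y \<otimes> t \<oplus> k" using div[OF x] by blast
      obtain a l where a: "a \<in> even_part R" "l \<in> \<jj>" "y = a \<otimes> g \<oplus> l" using g(2) y(1) by blast
      have c: "a \<in> carrier R" "l \<in> carrier R" "k \<in> carrier R"
        using a(1) j_closed(3)[OF a(2)] j_closed(3)[OF y(2)] by auto
      have "x = a \<otimes> (g \<otimes> t) \<oplus> (l \<otimes> t \<oplus> k)"
        unfolding y(3) a(3) using c gt(2) te(2) by algebra
      also have "l \<otimes> t = t \<otimes> l" using even_central[OF te(1) c(2)] by simp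
      finally have "x = a \<otimes> (g \<otimes> t) \<oplus> (t \<otimes> l \<oplus> k)" .
      moreover have "t \<otimes> l \<oplus> k \<in> \<jj>" by (intro j_closed(1,2) te a(2) y(2))
      ultimately show ?thesis using a(1) by blast
    qed
    then have "gen I" using gt(1) unfolding gen_def by blast
    then show False using Is(4) by simp
  qed
  then show ?thesis using N unfolding F_def gen_def by blast
qed

lemma reduction_coset_eq_iff:
  assumes "x \<in> even_part R" "y \<in> even_part R"
  shows "odd_ideal R +> x = odd_ideal R +> y \<longleftrightarrow> x \<ominus> y \<in> \<jj>"
  using coset_eq_iff[OF odd_ideal_ideal, of x y] assms by (simp add: minus_eq)

lemmas reduction_carrier = quotient_carrier_even[OF odd_ideal_ideal odd_part_odd_ideal]
lemmas reduction_mult = quotient_mult[OF odd_ideal_ideal]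
lemmas reduction_zero_iff = coset_zero_iff[OF odd_ideal_ideal]

text \<open>The reduction inherits locality, because even elements outside \<open>\<mm>\<close> are invertible.\<close>

lemma reduction_ideal_dichotomy:
  assumes Q: "ideal Q (R Quot odd_ideal R)"
  shows "Q \<subseteq> (+>) (odd_ideal R) ` \<mm> \<or> Q = carrier (R Quot odd_ideal R)"
proof (rule disjCI)
  assume ne: "Q \<noteq> carrier (R Quot odd_ideal R)"
  have sub: "Q \<subseteq> carrier (R Quot odd_ideal R)"
    using additive_subgroup.a_subset[OF ideal.axioms(1)[OF Q]] .
  show "Q \<subseteq> (+>) (odd_ideal R) ` \<mm>"
  proof
    fix q assume q: "q \<in> Q"
    then obtain a where a: "a \<in> even_part R" "q = odd_ideal R +> a" using sub reduction_carrier by auto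
    have "a \<in> \<mm>"
    proof (rule ccontr)
      assume "a \<notin> \<mm>"
      then obtain c where c: "c \<in> even_part R" "a \<otimes> c = \<one>" using even_unit a by blast
      have "q \<otimes>\<^bsub>R Quot odd_ideal R\<^esub> (odd_ideal R +> c) \<in> Q"
        by (rule ideal.I_r_closed[OF Q q]) (use c in \<open>simp add: quotient_carrier\<close>)
      then have "\<one>\<^bsub>R Quot odd_ideal R\<^esub> \<in> Q"
        using a c by (simp add: reduction_mult quotient_one)
      then show False using ideal.one_imp_carrier[OF Q] ne by simp
    qed
    then show "q \<in> (+>) (odd_ideal R) ` \<mm>" using a by blast
  qed
qed

lemma reduction_m_ideal:
  "ideal ((+>) (odd_ideal R) ` \<mm>) (R Quot odd_ideal R)"
  by (rule ring_ideal_imp_quot_ideal[OF odd_ideal_ideal m_ideal])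

lemma reduction_m_mem:
  assumes x: "x \<in> carrier R" and "odd_ideal R +> x \<in> (+>) (odd_ideal R) ` \<mm>"
  shows "x \<in> \<mm>"
proof -
  obtain p where p: "p \<in> \<mm>" "odd_ideal R +> x = odd_ideal R +> p" using assms(2) by blast
  have pc: "p \<in> carrier R" using ideal.Icarr[OF m_ideal p(1)] .
  have "x \<ominus> p \<in> \<mm>" using p(2) coset_eq_iff[OF odd_ideal_ideal x pc] odd_ideal_in_m by blast
  then have "(x \<ominus> p) \<oplus> p \<in> \<mm>"
    using p(1) even_submodule_closed(2)[OF ideal_even_submodule[OF m_ideal]] by blast
  moreover have "(x \<ominus> p) \<oplus> p = x" using x pc by algebra
  ultimately show ?thesis by simp
qed

text \<open>The uniformizer is an even lift of a generator of the maximal ideal.\<close>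

lemma dvr_reductionD:
  assumes "discrete_valuation_ring (super_reduction R)"
  shows "primeideal \<jj> (even_ring R)" "\<jj> \<noteq> \<nn>" "\<exists>t. reduced_uniformizer t"
proof -
  have D: "principal_domain (R Quot odd_ideal R)" "\<not> field (R Quot odd_ideal R)"
    using assms by (simp_all add: discrete_valuation_ring_def super_reduction_def)
  have dom: "domain (R Quot odd_ideal R)" using D(1) principal_domain.axioms(1) by blast
  have one: "\<one> \<notin> odd_ideal R" using quotient_domain_one[OF odd_ideal_ideal dom] .
  show "primeideal \<jj> (even_ring R)"
    unfolding primeideal_even_ring_iff
  proof (intro conjI ballI impI)
    show "even_submodule R \<jj>" by (rule even_submodule_odd_ideal)
    show "\<jj> \<subset> even_part R" using one one_even by blast
    fix a b assume "a \<in> even_part R" "b \<in> even_part R" "a \<otimes> b \<in> \<jj>"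
    then show "a \<in> \<jj> \<or> b \<in> \<jj>"
      using quotient_domain_prime[OF odd_ideal_ideal dom, of a b] by auto
  qed
  show "\<jj> \<noteq> \<nn>"
  proof
    assume eq: "\<jj> = \<nn>"
    have "\<mm> \<subseteq> odd_ideal R"
    proof
      fix x assume "x \<in> \<mm>"
      then obtain a b where ab: "a \<in> \<nn>" "b \<in> odd_part R" "x = a \<oplus> b" using m_decompose by blast
      have "a \<in> odd_ideal R" "b \<in> odd_ideal R" using ab(1,2) eq odd_part_odd_ideal by auto
      then show "x \<in> odd_ideal R" unfolding ab(3)
        using even_submodule_closed(2)[OF ideal_even_submodule[OF odd_ideal_ideal]] by blast
    qed
    then have "\<mm> = odd_ideal R" using odd_ideal_in_m by blast
    then show False using D(2) residue_field by simp
  qed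
  obtain g where g: "g \<in> carrier (R Quot odd_ideal R)"
    "(+>) (odd_ideal R) ` \<mm> = PIdl\<^bsub>R Quot odd_ideal R\<^esub> g"
    using principal_domain.exists_gen[OF D(1) reduction_m_ideal] by blast
  obtain t where t: "t \<in> even_part R" "g = odd_ideal R +> t" using g(1) reduction_carrier by auto
  have "g \<in> PIdl\<^bsub>R Quot odd_ideal R\<^esub> g"
    by (rule ring.cgenideal_self[OF ideal.quotient_is_ring[OF odd_ideal_ideal] g(1)])
  then have "t \<in> \<mm>" using reduction_m_mem[of t] t g(2) by simp
  have "reduced_uniformizer t" unfolding reduced_uniformizer_def
  proof (intro conjI ballI)
    show "t \<in> \<nn>" using \<open>t \<in> \<mm>\<close> t(1) by simp
    fix x assume x: "x \<in> \<nn>"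
    then have "odd_ideal R +> x \<in> PIdl\<^bsub>R Quot odd_ideal R\<^esub> g" using g(2) by blast
    then obtain c where c: "c \<in> carrier (R Quot odd_ideal R)"
      "odd_ideal R +> x = c \<otimes>\<^bsub>R Quot odd_ideal R\<^esub> g"
      unfolding cgenideal_def by blast
    obtain a where a: "a \<in> even_part R" "c = odd_ideal R +> a" using c(1) reduction_carrier by auto
    have "odd_ideal R +> x = odd_ideal R +> (a \<otimes> t)" using c(2) a t by (simp add: reduction_mult)
    then have k: "x \<ominus> a \<otimes> t \<in> \<jj>" using reduction_coset_eq_iff[of x "a \<otimes> t"] x a t by simp
    have carr: "x \<in> carrier R" "a \<in> carrier R" "t \<in> carrier R" using x a t by auto
    have "x = a \<otimes> t \<oplus> (x \<ominus> a \<otimes> t)" using carr by algebra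
    then show "\<exists>a\<in>even_part R. \<exists>k\<in>\<jj>. x = a \<otimes> t \<oplus> k" using a(1) k by blast
  qed
  then show "\<exists>t. reduced_uniformizer t" by blast
qed

lemma dvr_reductionI:
  assumes P: "primeideal \<jj> (even_ring R)" and ne: "\<jj> \<noteq> \<nn>" and t: "reduced_uniformizer t"
  shows "discrete_valuation_ring (super_reduction R)"
proof -
  let ?J = "odd_ideal R" and ?Q = "R Quot odd_ideal R"
  have cring: "cring ?Q" by (rule quotient_cring[OF odd_ideal_ideal odd_part_odd_ideal])
  interpret Q: cring ?Q by (rule cring)
  have one: "\<one> \<notin> ?J" using odd_ideal_in_m one_notin_m by blast
  have prime: "a \<in> \<jj> \<or> b \<in> \<jj>" if "a \<in> even_part R" "b \<in> even_part R" "a \<otimes> b \<in> \<jj>" for a b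
    using P that unfolding primeideal_even_ring_iff by blast
  have dom: "domain ?Q"
  proof (intro domain.intro cring domain_axioms.intro)
    show "\<one>\<^bsub>?Q\<^esub> \<noteq> \<zero>\<^bsub>?Q\<^esub>" using reduction_zero_iff[OF one_closed] one quotient_one by metis
    fix a b assume ab: "a \<otimes>\<^bsub>?Q\<^esub> b = \<zero>\<^bsub>?Q\<^esub>" "a \<in> carrier ?Q" "b \<in> carrier ?Q"
    then obtain x y where xy: "x \<in> even_part R" "y \<in> even_part R" "a = ?J +> x" "b = ?J +> y"
      using reduction_carrier by auto
    have "?J +> (x \<otimes> y) = \<zero>\<^bsub>?Q\<^esub>" using ab(1) xy by (simp add: reduction_mult)
    then have "x \<otimes> y \<in> \<jj>" using reduction_zero_iff[of "x \<otimes> y"] xy(1,2) by simp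
    then have "x \<in> ?J \<or> y \<in> ?J" using prime[OF xy(1,2)] by blast
    then show "a = \<zero>\<^bsub>?Q\<^esub> \<or> b = \<zero>\<^bsub>?Q\<^esub>" using reduction_zero_iff[of x] reduction_zero_iff[of y] xy by auto
  qed
  have principal: "\<exists>a\<in>carrier ?Q. I = PIdl\<^bsub>?Q\<^esub> a" if I: "ideal I ?Q" for I
  proof -
    define N where "N = {x \<in> even_part R. ?J +> x \<in> I}"
    have "ideal {x \<in> carrier R. ?J +> x \<in> I} R"
      using ring_hom_ring.ideal_vimage[OF quotient_hom[OF odd_ideal_ideal] I] .
    then have "even_submodule R ({x \<in> carrier R. ?J +> x \<in> I} \<inter> even_part R)"
      using even_submodule_Int ideal_even_submodule even_submodule_even by blast
    moreover have "{x \<in> carrier R. ?J +> x \<in> I} \<inter> even_part R = N" by (auto simp: N_def)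
    ultimately have N: "even_submodule R N" by simp
    have "\<zero>\<^bsub>?Q\<^esub> \<in> I" using additive_subgroup.zero_closed[OF ideal.axioms(1)[OF I]] .
    have jN: "\<jj> \<subseteq> N"
    proof
      fix x assume x: "x \<in> \<jj>"
      then have "?J +> x = \<zero>\<^bsub>?Q\<^esub>" using reduction_zero_iff[of x] by simp
      then show "x \<in> N" using x \<open>\<zero>\<^bsub>?Q\<^esub> \<in> I\<close> unfolding N_def by simp
    qed
    have "N \<subseteq> even_part R" by (auto simp: N_def)
    obtain g where g: "g \<in> N" "\<forall>y\<in>N. \<exists>a\<in>even_part R. \<exists>k\<in>\<jj>. y = a \<otimes> g \<oplus> k"
      using even_submodule_principal_mod_j[OF t N \<open>N \<subseteq> even_part R\<close> jN] by blast
    have ge: "g \<in> even_part R" "g \<in> carrier R" using g(1) by (auto simp: N_def)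
    have gI: "?J +> g \<in> I" using g(1) by (simp add: N_def)
    have gc: "?J +> g \<in> carrier ?Q" using ge by (simp add: quotient_carrier)
    have "I \<subseteq> PIdl\<^bsub>?Q\<^esub> (?J +> g)"
    proof
      fix q assume q: "q \<in> I"
      then obtain y where y: "y \<in> even_part R" "q = ?J +> y"
        using ideal.Icarr[OF I q] reduction_carrier by auto
      then have "y \<in> N" using q by (simp add: N_def)
      then obtain a k where a: "a \<in> even_part R" "k \<in> \<jj>" "y = a \<otimes> g \<oplus> k" using g(2) by blast
      have c: "a \<in> carrier R" "k \<in> carrier R" using a(1) j_closed(3)[OF a(2)] by auto
      have "y \<ominus> a \<otimes> g = k" unfolding a(3) using c ge(2) by algebra
      then have "?J +> y = ?J +> (a \<otimes> g)" using reduction_coset_eq_iff[of y "a \<otimes> g"] a(1,2) ge(1) y(1) by simp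
      then have "q = (?J +> a) \<otimes>\<^bsub>?Q\<^esub> (?J +> g)" using y(2) c ge(2) by (simp add: reduction_mult)
      moreover have "?J +> a \<in> carrier ?Q" using c by (simp add: quotient_carrier)
      ultimately show "q \<in> PIdl\<^bsub>?Q\<^esub> (?J +> g)" unfolding cgenideal_def by blast
    qed
    moreover have "PIdl\<^bsub>?Q\<^esub> (?J +> g) \<subseteq> I" by (rule Q.cgenideal_minimal[OF I gI])
    ultimately show ?thesis using gc by blast
  qed
  have pid: "principal_domain ?Q"
    by (intro principal_domain.intro dom principal_domain_axioms.intro principal)
  have tn: "t \<in> \<mm>" "t \<in> even_part R" "t \<in> carrier R" using t by (auto simp: reduced_uniformizer_def)
  have "t \<notin> ?J"
  proof
    assume tJ: "t \<in> ?J"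
    have "\<nn> \<subseteq> \<jj>"
    proof
      fix x assume "x \<in> \<nn>"
      then obtain a k where a: "a \<in> even_part R" "k \<in> \<jj>" "x = a \<otimes> t \<oplus> k"
        using t unfolding reduced_uniformizer_def by blast
      show "x \<in> \<jj>" unfolding a(3) by (intro j_closed(1,2) a(1,2)) (use tJ tn in simp)
    qed
    then show False using ne j_subset_n by blast
  qed
  have nofield: "\<not> field ?Q"
  proof
    assume f: "field ?Q"
    have "?J +> t \<in> carrier ?Q - {\<zero>\<^bsub>?Q\<^esub>}"
      using \<open>t \<notin> ?J\<close> reduction_zero_iff[OF tn(3)] tn(3) by (simp add: quotient_carrier)
    then have "?J +> t \<in> Units ?Q" using field.field_Units[OF f] by simp
    then obtain c where c: "c \<in> carrier ?Q" "(?J +> t) \<otimes>\<^bsub>?Q\<^esub> c = \<one>\<^bsub>?Q\<^esub>"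
      using Q.Units_r_inv_ex by blast
    obtain x where x: "x \<in> even_part R" "c = ?J +> x" using c(1) reduction_carrier by auto
    have "?J +> \<one> = ?J +> (t \<otimes> x)" using c(2) x tn by (simp add: reduction_mult quotient_one)
    moreover have "t \<otimes> x \<in> \<mm>" using ideal.I_r_closed[OF m_ideal tn(1)] x by simp
    ultimately show False using reduction_m_mem[OF one_closed] one_notin_m by blast
  qed
  let ?M = "(+>) ?J ` \<mm>"
  have Mne: "?M \<noteq> carrier ?Q"
  proof
    assume "?M = carrier ?Q"
    then have "?J +> \<one> \<in> ?M" by (simp add: quotient_carrier)
    then show False using reduction_m_mem[OF one_closed] one_notin_m by blast
  qed
  have "maximalideal ?M ?Q"
  proof (rule maximalidealI)
    fix I assume "ideal I ?Q" "?M \<subseteq> I"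
    then show "I = ?M \<or> I = carrier ?Q" using reduction_ideal_dichotomy[of I] by blast
  qed (use reduction_m_ideal Mne in auto)
  moreover have "I = ?M" if I: "maximalideal I ?Q" for I
  proof -
    have Ii: "ideal I ?Q" "carrier ?Q \<noteq> I"
      using I maximalideal.axioms(1) maximalideal.I_notcarr by blast+
    then have "I \<subseteq> ?M" using reduction_ideal_dichotomy by blast
    moreover have "?M \<subseteq> carrier ?Q"
      using additive_subgroup.a_subset[OF ideal.axioms(1)[OF reduction_m_ideal]] .
    ultimately show ?thesis using maximalideal.I_maximal[OF I reduction_m_ideal] Mne by blast
  qed
  ultimately have "\<exists>!M. maximalideal M ?Q" by blast
  then show ?thesis using pid nofield by (simp add: discrete_valuation_ring_def super_reduction_def)
qed

end

section \<open>The cotangent space\<close>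

context noetherian_local_superring
begin

abbreviation cotangent_space :: "'a set \<Rightarrow> ('a set, 'a set) module" where
  "cotangent_space P \<equiv> cotangent R \<mm> P"

lemma cotangent_simps:
  "carrier (cotangent_space P) = (+>) \<mm>\<^sup>2 ` (\<mm> \<inter> P)"
  "\<zero>\<^bsub>cotangent_space P\<^esub> = \<mm>\<^sup>2"
  "v \<oplus>\<^bsub>cotangent_space P\<^esub> w = v <+>\<^bsub>R\<^esub> w"
  "c \<odot>\<^bsub>cotangent_space P\<^esub> v = rcoset_mult R \<mm>\<^sup>2 c v"
  by (simp_all add: cotangent_def)

lemma coset_memI:
  assumes "x \<in> carrier R" "ideal I R" shows "x \<in> I +> x"
proof -
  have "\<zero> \<in> I" using additive_subgroup.zero_closed[OF ideal.axioms(1)[OF assms(2)]] .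
  then have "\<zero> \<oplus> x \<in> I +> x" unfolding a_r_coset_def' by blast
  then show ?thesis using assms(1) by simp
qed

lemma cotangent_smult:
  assumes a: "a \<in> carrier R" and x: "x \<in> \<mm>"
  shows "(\<mm> +> a) \<odot>\<^bsub>cotangent_space P\<^esub> (\<mm>\<^sup>2 +> x) = \<mm>\<^sup>2 +> (a \<otimes> x)"
proof -
  have xc: "x \<in> carrier R" using ideal.Icarr[OF m_ideal x] .
  have eq: "\<mm>\<^sup>2 +> (a' \<otimes> x') = \<mm>\<^sup>2 +> (a \<otimes> x)"
    if a': "a' \<in> \<mm> +> a" and x': "x' \<in> \<mm>\<^sup>2 +> x" for a' x'
  proof -
    obtain h where h: "h \<in> \<mm>" "a' = h \<oplus> a" using a' unfolding a_r_coset_def' by blast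
    obtain k where k: "k \<in> \<mm>\<^sup>2" "x' = k \<oplus> x" using x' unfolding a_r_coset_def' by blast
    have hc: "h \<in> carrier R" using ideal.Icarr[OF m_ideal h(1)] .
    have kc: "k \<in> carrier R" using ideal.Icarr[OF msq_ideal k(1)] .
    have "a' \<otimes> x' \<ominus> a \<otimes> x = (h \<otimes> k \<oplus> h \<otimes> x) \<oplus> a \<otimes> k"
      unfolding h(2) k(2) using hc kc a xc by algebra
    moreover have "h \<otimes> k \<in> \<mm>\<^sup>2" "a \<otimes> k \<in> \<mm>\<^sup>2"
      using ideal.I_l_closed[OF msq_ideal k(1)] hc a by simp_all
    moreover have "h \<otimes> x \<in> \<mm>\<^sup>2" using h(1) x by (rule ideal_prod.prod)
    ultimately have "a' \<otimes> x' \<ominus> a \<otimes> x \<in> \<mm>\<^sup>2"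
      using even_submodule_closed(2)[OF ideal_even_submodule[OF msq_ideal]] by simp
    then show ?thesis
      using coset_eq_iff[OF msq_ideal, of "a' \<otimes> x'" "a \<otimes> x"] h(2) k(2) hc kc a xc by simp
  qed
  have "a \<in> \<mm> +> a" "x \<in> \<mm>\<^sup>2 +> x" using coset_memI a xc m_ideal msq_ideal by auto
  then show ?thesis unfolding cotangent_simps rcoset_mult_def using eq by blast
qed

lemma cotangent_add:
  assumes "x \<in> carrier R" "y \<in> carrier R"
  shows "(\<mm>\<^sup>2 +> x) \<oplus>\<^bsub>cotangent_space P\<^esub> (\<mm>\<^sup>2 +> y) = \<mm>\<^sup>2 +> (x \<oplus> y)"
  unfolding cotangent_simps using ideal.a_rcos_sum[OF msq_ideal assms] .

lemma cotangent_zero: "\<zero>\<^bsub>cotangent_space P\<^esub> = \<mm>\<^sup>2 +> \<zero>"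
proof -
  have "\<zero> \<in> \<mm>\<^sup>2" using additive_subgroup.zero_closed[OF ideal.axioms(1)[OF msq_ideal]] .
  then show ?thesis using a_rcos_zero[OF msq_ideal] by (simp add: cotangent_simps)
qed

lemma even_submodule_m_Int: "even_submodule R P \<Longrightarrow> even_submodule R (\<mm> \<inter> P)"
  by (rule even_submodule_Int[OF ideal_even_submodule[OF m_ideal]])

lemma cotangent_vectorspace:
  assumes P: "even_submodule R P"
  shows "vectorspace (R Quot \<mm>) (cotangent_space P)"
proof -
  note mPc = even_submodule_closed[OF even_submodule_m_Int[OF P]]
  interpret K: field "R Quot \<mm>" by (rule residue_field)
  have group: "abelian_group (cotangent_space P)"
  proof (rule abelian_groupI)
    fix v w assume "v \<in> carrier (cotangent_space P)" "w \<in> carrier (cotangent_space P)"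
    then obtain x y where *: "x \<in> \<mm> \<inter> P" "v = \<mm>\<^sup>2 +> x" "y \<in> \<mm> \<inter> P" "w = \<mm>\<^sup>2 +> y"
      unfolding cotangent_simps by blast
    note c = mPc(6)[OF *(1)] mPc(6)[OF *(3)]
    show "v \<oplus>\<^bsub>cotangent_space P\<^esub> w \<in> carrier (cotangent_space P)"
      unfolding *(2,4) cotangent_add[OF c] unfolding cotangent_simps
      using mPc(2)[OF *(1,3)] by (rule imageI)
    show "v \<oplus>\<^bsub>cotangent_space P\<^esub> w = w \<oplus>\<^bsub>cotangent_space P\<^esub> v"
      unfolding *(2,4) cotangent_add[OF c] cotangent_add[OF c(2,1)] a_comm[OF c] ..
    fix u assume "u \<in> carrier (cotangent_space P)"
    then obtain z where z: "z \<in> \<mm> \<inter> P" "u = \<mm>\<^sup>2 +> z" unfolding cotangent_simps by blast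
    note zc = mPc(6)[OF z(1)]
    show "v \<oplus>\<^bsub>cotangent_space P\<^esub> w \<oplus>\<^bsub>cotangent_space P\<^esub> u = v \<oplus>\<^bsub>cotangent_space P\<^esub> (w \<oplus>\<^bsub>cotangent_space P\<^esub> u)"
      using c zc unfolding *(2,4) z(2) by (simp add: cotangent_add a_assoc)
  next
    show "\<zero>\<^bsub>cotangent_space P\<^esub> \<in> carrier (cotangent_space P)"
      unfolding cotangent_zero unfolding cotangent_simps using mPc(1) by (rule imageI)
    fix v assume "v \<in> carrier (cotangent_space P)"
    then obtain x where x: "x \<in> \<mm> \<inter> P" "v = \<mm>\<^sup>2 +> x" unfolding cotangent_simps by blast
    note c = mPc(6)[OF x(1)]
    show "\<zero>\<^bsub>cotangent_space P\<^esub> \<oplus>\<^bsub>cotangent_space P\<^esub> v = v"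
      unfolding x(2) cotangent_zero using c by (simp add: cotangent_add)
    have "(\<mm>\<^sup>2 +> \<ominus> x) \<oplus>\<^bsub>cotangent_space P\<^esub> v = \<zero>\<^bsub>cotangent_space P\<^esub>"
      unfolding x(2) cotangent_zero using c by (simp add: cotangent_add l_neg)
    moreover have "\<mm>\<^sup>2 +> \<ominus> x \<in> carrier (cotangent_space P)"
      unfolding cotangent_simps using mPc(3)[OF x(1)] by (rule imageI)
    ultimately show "\<exists>w\<in>carrier (cotangent_space P). w \<oplus>\<^bsub>cotangent_space P\<^esub> v = \<zero>\<^bsub>cotangent_space P\<^esub>" by blast
  qed
  have rep: "\<exists>a\<in>even_part R. c = \<mm> +> a" if "c \<in> carrier (R Quot \<mm>)" for c
    using that quotient_carrier_even[OF m_ideal odd_in_m] by blast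
  have "module (R Quot \<mm>) (cotangent_space P)"
  proof (rule moduleI[OF K.is_cring group])
    fix c v assume "c \<in> carrier (R Quot \<mm>)" "v \<in> carrier (cotangent_space P)"
    then obtain a x where a: "a \<in> even_part R" "c = \<mm> +> a" and x: "x \<in> \<mm> \<inter> P" "v = \<mm>\<^sup>2 +> x"
      using rep unfolding cotangent_simps by blast
    have xm: "x \<in> \<mm>" "x \<in> carrier R" "a \<in> carrier R" using x(1) mPc(6)[OF x(1)] a(1) by auto
    have axm: "a \<otimes> x \<in> \<mm>" using mPc(5)[OF a(1) x(1)] by blast
    show "c \<odot>\<^bsub>cotangent_space P\<^esub> v \<in> carrier (cotangent_space P)"
      unfolding a(2) x(2) cotangent_smult[OF xm(3,1)] unfolding cotangent_simps
      using mPc(5)[OF a(1) x(1)] by (rule imageI)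
    { fix d assume "d \<in> carrier (R Quot \<mm>)"
      then obtain b where b: "b \<in> even_part R" "d = \<mm> +> b" using rep by blast
      have bc: "b \<in> carrier R" using b by simp
      have bxm: "b \<otimes> x \<in> \<mm>" using mPc(5)[OF b(1) x(1)] by blast
      show "(c \<oplus>\<^bsub>R Quot \<mm>\<^esub> d) \<odot>\<^bsub>cotangent_space P\<^esub> v = (c \<odot>\<^bsub>cotangent_space P\<^esub> v) \<oplus>\<^bsub>cotangent_space P\<^esub> (d \<odot>\<^bsub>cotangent_space P\<^esub> v)"
        unfolding a(2) b(2) x(2) using xm bc
        by (simp add: quotient_add[OF m_ideal] cotangent_smult cotangent_add l_distr)
      show "(c \<otimes>\<^bsub>R Quot \<mm>\<^esub> d) \<odot>\<^bsub>cotangent_space P\<^esub> v = c \<odot>\<^bsub>cotangent_space P\<^esub> (d \<odot>\<^bsub>cotangent_space P\<^esub> v)"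
        unfolding a(2) b(2) x(2) using xm bc bxm
        by (simp add: quotient_mult[OF m_ideal] cotangent_smult m_assoc) }
    { fix w assume "w \<in> carrier (cotangent_space P)"
      then obtain y where y: "y \<in> \<mm> \<inter> P" "w = \<mm>\<^sup>2 +> y" unfolding cotangent_simps by blast
      have ym: "y \<in> \<mm>" "y \<in> carrier R" "x \<oplus> y \<in> \<mm>"
        using y(1) mPc(6)[OF y(1)] mPc(2)[OF x(1) y(1)] by auto
      show "c \<odot>\<^bsub>cotangent_space P\<^esub> (v \<oplus>\<^bsub>cotangent_space P\<^esub> w) = (c \<odot>\<^bsub>cotangent_space P\<^esub> v) \<oplus>\<^bsub>cotangent_space P\<^esub> (c \<odot>\<^bsub>cotangent_space P\<^esub> w)"
        unfolding a(2) x(2) y(2) using xm ym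
        by (simp add: cotangent_smult cotangent_add r_distr) }
  next
    fix v assume "v \<in> carrier (cotangent_space P)"
    then obtain x where x: "x \<in> \<mm> \<inter> P" "v = \<mm>\<^sup>2 +> x" unfolding cotangent_simps by blast
    have xm: "x \<in> \<mm>" "x \<in> carrier R" using x(1) mPc(6)[OF x(1)] by auto
    show "\<one>\<^bsub>R Quot \<mm>\<^esub> \<odot>\<^bsub>cotangent_space P\<^esub> v = v"
      unfolding x(2) quotient_one using xm by (simp add: cotangent_smult)
  qed
  then show ?thesis by (rule vectorspace.intro) (rule residue_field)
qed

text \<open>The correspondence between subspaces of the cotangent space and submodules that contain the part of
\<open>\<mm>\<^sup>2\<close> of the given parity: pulling back a span here, pushing a submodule forward in the next lemma.
Together they translate generation in the cotangent space without linear combinations.\<close>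

lemma span_vimage:
  assumes P: "even_submodule R P" and S: "S \<subseteq> \<mm> \<inter> P"
  defines "N \<equiv> {x \<in> \<mm> \<inter> P. \<mm>\<^sup>2 +> x \<in> module.span (R Quot \<mm>) (cotangent_space P) ((+>) \<mm>\<^sup>2 ` S)}"
  shows "even_submodule R N" "S \<subseteq> N" "\<mm>\<^sup>2 \<inter> P \<subseteq> N"
proof -
  interpret V: vectorspace "R Quot \<mm>" "cotangent_space P" by (rule cotangent_vectorspace[OF P])
  note mPc = even_submodule_closed[OF even_submodule_m_Int[OF P]]
  have sub: "(+>) \<mm>\<^sup>2 ` S \<subseteq> carrier (cotangent_space P)" unfolding cotangent_simps using S by (rule image_mono)
  have span: "submodule (R Quot \<mm>) (V.span ((+>) \<mm>\<^sup>2 ` S)) (cotangent_space P)" by (rule V.span_is_submodule[OF sub])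
  have NI: "x \<in> N \<longleftrightarrow> x \<in> \<mm> \<inter> P \<and> \<mm>\<^sup>2 +> x \<in> V.span ((+>) \<mm>\<^sup>2 ` S)" for x
    by (simp add: N_def)
  show "even_submodule R N"
  proof (rule even_submoduleI)
    show "N \<subseteq> carrier R" using mPc(6) unfolding N_def by blast
    show "\<zero> \<in> N" unfolding NI using mPc(1) submodule.zero_closed[OF span] by (simp add: cotangent_zero)
    show "x \<oplus> y \<in> N" if "x \<in> N" "y \<in> N" for x y
    proof -
      have x: "x \<in> \<mm> \<inter> P" "\<mm>\<^sup>2 +> x \<in> V.span ((+>) \<mm>\<^sup>2 ` S)" using that(1) unfolding NI by simp_all
      have y: "y \<in> \<mm> \<inter> P" "\<mm>\<^sup>2 +> y \<in> V.span ((+>) \<mm>\<^sup>2 ` S)" using that(2) unfolding NI by simp_all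
      show ?thesis unfolding NI
        using submodule.m_closed[OF span x(2) y(2)] cotangent_add[OF mPc(6)[OF x(1)] mPc(6)[OF y(1)]]
          mPc(2)[OF x(1) y(1)] by simp
    qed
    show "a \<otimes> x \<in> N" if a: "a \<in> even_part R" and "x \<in> N" for a x
    proof -
      have x: "x \<in> \<mm> \<inter> P" "\<mm>\<^sup>2 +> x \<in> V.span ((+>) \<mm>\<^sup>2 ` S)" using that(2) unfolding NI by simp_all
      have "\<mm> +> a \<in> carrier (R Quot \<mm>)" using a by (simp add: quotient_carrier)
      then have "(\<mm> +> a) \<odot>\<^bsub>cotangent_space P\<^esub> (\<mm>\<^sup>2 +> x) \<in> V.span ((+>) \<mm>\<^sup>2 ` S)"
        by (rule submodule.smult_closed[OF span _ x(2)])
      then have "\<mm>\<^sup>2 +> a \<otimes> x \<in> V.span ((+>) \<mm>\<^sup>2 ` S)"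
        using x(1) by (simp only: cotangent_smult[OF even_carrier[OF a]] Int_iff)
      then show ?thesis unfolding NI using mPc(5)[OF a x(1)] by (rule conjI[rotated])
    qed
  qed
  show "S \<subseteq> N"
  proof
    fix x assume x: "x \<in> S"
    then have "\<mm>\<^sup>2 +> x \<in> V.span ((+>) \<mm>\<^sup>2 ` S)" using V.in_own_span[OF sub] by blast
    then show "x \<in> N" unfolding NI using x S by blast
  qed
  show "\<mm>\<^sup>2 \<inter> P \<subseteq> N"
  proof
    fix x assume x: "x \<in> \<mm>\<^sup>2 \<inter> P"
    then have "\<mm>\<^sup>2 +> x = \<zero>\<^bsub>cotangent_space P\<^esub>" using a_rcos_zero[OF msq_ideal, of x] by (simp add: cotangent_simps)
    then show "x \<in> N" unfolding NI using x msq_subset submodule.zero_closed[OF span] by auto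
  qed
qed

lemma span_cosetD:
  assumes P: "even_submodule R P" and K: "even_submodule R K" "S \<subseteq> K" "\<mm>\<^sup>2 \<inter> P \<subseteq> K"
    and S: "S \<subseteq> \<mm> \<inter> P" and KP: "K \<subseteq> P"
    and x: "x \<in> \<mm> \<inter> P" "\<mm>\<^sup>2 +> x \<in> module.span (R Quot \<mm>) (cotangent_space P) ((+>) \<mm>\<^sup>2 ` S)"
  shows "x \<in> K"
proof -
  interpret V: vectorspace "R Quot \<mm>" "cotangent_space P" by (rule cotangent_vectorspace[OF P])
  have mK: "even_submodule R (\<mm> \<inter> K)" by (rule even_submodule_m_Int[OF K(1)])
  note mKc = even_submodule_closed[OF mK]
  have sub: "submodule (R Quot \<mm>) ((+>) \<mm>\<^sup>2 ` (\<mm> \<inter> K)) (cotangent_space P)"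
  proof (rule submodule.intro[OF V.module_axioms])
    show "(+>) \<mm>\<^sup>2 ` (\<mm> \<inter> K) \<subseteq> carrier (cotangent_space P)"
      unfolding cotangent_simps using KP by (intro image_mono) blast
    show "\<zero>\<^bsub>cotangent_space P\<^esub> \<in> (+>) \<mm>\<^sup>2 ` (\<mm> \<inter> K)" unfolding cotangent_zero using mKc(1) by (rule imageI)
    fix v assume "v \<in> (+>) \<mm>\<^sup>2 ` (\<mm> \<inter> K)"
    then obtain x where x: "x \<in> \<mm> \<inter> K" "v = \<mm>\<^sup>2 +> x" by blast
    { fix w assume "w \<in> (+>) \<mm>\<^sup>2 ` (\<mm> \<inter> K)"
      then obtain y where y: "y \<in> \<mm> \<inter> K" "w = \<mm>\<^sup>2 +> y" by blast
      show "v \<oplus>\<^bsub>cotangent_space P\<^esub> w \<in> (+>) \<mm>\<^sup>2 ` (\<mm> \<inter> K)"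
        unfolding x(2) y(2) cotangent_add[OF mKc(6)[OF x(1)] mKc(6)[OF y(1)]]
        using mKc(2)[OF x(1) y(1)] by (rule imageI) }
    fix c assume "c \<in> carrier (R Quot \<mm>)"
    then obtain a where a: "a \<in> even_part R" "c = \<mm> +> a"
      using quotient_carrier_even[OF m_ideal odd_in_m] by blast
    have xm: "x \<in> \<mm>" using x(1) by blast
    show "c \<odot>\<^bsub>cotangent_space P\<^esub> v \<in> (+>) \<mm>\<^sup>2 ` (\<mm> \<inter> K)"
      unfolding a(2) x(2) cotangent_smult[OF even_carrier[OF a(1)] xm]
      using mKc(5)[OF a(1) x(1)] by (rule imageI)
  qed
  have "(+>) \<mm>\<^sup>2 ` S \<subseteq> (+>) \<mm>\<^sup>2 ` (\<mm> \<inter> K)" using S K(2) by (intro image_mono) blast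
  then have "V.span ((+>) \<mm>\<^sup>2 ` S) \<subseteq> (+>) \<mm>\<^sup>2 ` (\<mm> \<inter> K)" by (rule V.span_is_subset[OF _ sub])
  then obtain k where k: "k \<in> \<mm> \<inter> K" "\<mm>\<^sup>2 +> x = \<mm>\<^sup>2 +> k" using x(2) by blast
  have c: "x \<in> carrier R" "k \<in> carrier R"
    using mKc(6)[OF k(1)] even_submodule_closed(6)[OF even_submodule_m_Int[OF P] x(1)] by auto
  have "x \<ominus> k \<in> \<mm>\<^sup>2" using coset_eq_iff[OF msq_ideal c] k(2) by simp
  moreover have "x \<ominus> k \<in> P" using even_submodule_closed(4)[OF P, of x k] x(1) k(1) KP by blast
  ultimately have "x \<ominus> k \<in> K" using K(3) by blast
  then have "(x \<ominus> k) \<oplus> k \<in> K" using even_submodule_closed(2)[OF K(1)] k(1) by blast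
  moreover have "(x \<ominus> k) \<oplus> k = x" using c by algebra
  ultimately show ?thesis by simp
qed

text \<open>A maximal one among the spans of finite subsets is everything.\<close>

lemma finitely_generated:
  assumes P: "P = even_part R \<or> P = odd_part R" and N: "even_submodule R N" "N \<subseteq> P"
  obtains S where "finite S" "S \<subseteq> N" "N \<subseteq> even_span R S"
proof -
  define F where "F = {even_span R S | S. finite S \<and> S \<subseteq> N}"
  have NR: "N \<subseteq> carrier R" using even_submodule_closed(6)[OF N(1)] by blast
  have FP: "even_submodule R K \<and> K \<subseteq> P" if KF: "K \<in> F" for K
  proof -
    obtain S where S: "K = even_span R S" "S \<subseteq> N" using KF unfolding F_def by blast
    have "even_span R S \<subseteq> N" using even_span_minimal[OF N(1) S(2)] .
    moreover have "even_submodule R (even_span R S)" using even_submodule_span S(2) NR by blast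
    ultimately show ?thesis using S(1) N(2) by blast
  qed
  have "even_span R {} \<in> F" unfolding F_def by blast
  then obtain K where K: "K \<in> F" "\<forall>K'\<in>F. K \<subseteq> K' \<longrightarrow> K' = K"
    using even_submodule_maximal[OF noetherian P _ FP] by blast
  obtain S where S: "K = even_span R S" "finite S" "S \<subseteq> N" using K(1) unfolding F_def by blast
  have "N \<subseteq> even_span R S"
  proof
    fix x assume x: "x \<in> N"
    have in_F: "even_span R (insert x S) \<in> F"
      unfolding F_def using S x by (intro CollectI exI[of _ "insert x S"]) simp
    have sup: "insert x S \<subseteq> even_span R (insert x S)" by (rule even_span_superset)
    have "insert x S \<subseteq> carrier R" using S(3) x NR by blast
    then have "even_span R S \<subseteq> even_span R (insert x S)"
      using sup by (intro even_span_minimal even_submodule_span) simp_all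
    then have "even_span R (insert x S) = even_span R S" using K(2) in_F S(1) by blast
    then show "x \<in> even_span R S" using sup by blast
  qed
  then show ?thesis using that S by blast
qed

lemma cotangent_basis:
  assumes P: "P = even_part R \<or> P = odd_part R"
  obtains B where "finite B" "vectorspace.basis (R Quot \<mm>) (cotangent_space P) B" "card B = cotangent_dim R \<mm> P"
proof -
  have Ps: "even_submodule R P" using P even_submodule_even even_submodule_odd by blast
  interpret V: vectorspace "R Quot \<mm>" "cotangent_space P" by (rule cotangent_vectorspace[OF Ps])
  obtain S where S: "finite S" "S \<subseteq> \<mm> \<inter> P" "\<mm> \<inter> P \<subseteq> even_span R S"
    using finitely_generated[OF P even_submodule_m_Int[OF Ps]] by blast
  let ?A = "(+>) \<mm>\<^sup>2 ` S"
  have A: "?A \<subseteq> carrier (cotangent_space P)" unfolding cotangent_simps using S(2) by (rule image_mono)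
  have "carrier (cotangent_space P) \<subseteq> V.span ?A"
    unfolding cotangent_simps
    using S(3) even_span_minimal[OF span_vimage(1,2)[OF Ps S(2)]] by blast
  then have "V.gen_set ?A" using V.span_is_subset2[OF A] by blast
  then have "V.fin_dim" unfolding V.fin_dim_def using A S(1) by blast
  then obtain B where "finite B" "V.basis B" using V.finite_basis_exists by blast
  then show ?thesis using that V.dim_basis unfolding cotangent_dim_def by metis
qed

lemma odd_cotangent_basis_exists:
  obtains zs where "length zs = cotangent_dim R \<mm> (odd_part R)" "odd_cotangent_basis R \<mm> zs"
proof -
  interpret V: vectorspace "R Quot \<mm>" "cotangent_space (odd_part R)"
    by (rule cotangent_vectorspace[OF even_submodule_odd])
  obtain B where B: "finite B" "V.basis B" "card B = cotangent_dim R \<mm> (odd_part R)"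
    using cotangent_basis[of "odd_part R"] by blast
  obtain bs where bs: "set bs = B" "distinct bs" using finite_distinct_list[OF B(1)] by blast
  have "\<exists>z. z \<in> \<mm> \<inter> odd_part R \<and> b = \<mm>\<^sup>2 +> z" if "b \<in> B" for b
    using B(2) that unfolding V.basis_def cotangent_simps by blast
  then obtain f where f: "\<And>b. b \<in> B \<Longrightarrow> f b \<in> \<mm> \<inter> odd_part R \<and> b = \<mm>\<^sup>2 +> f b" by metis
  have map: "map (\<lambda>z. \<mm>\<^sup>2 +> z) (map f bs) = bs"
    unfolding map_map using f bs(1) by (intro map_idI) simp
  have "set (map f bs) \<subseteq> \<mm> \<inter> odd_part R" using f bs(1) by auto
  then have "odd_cotangent_basis R \<mm> (map f bs)"
    unfolding odd_cotangent_basis_def Let_def map using B(2) bs by simp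
  moreover have "length (map f bs) = cotangent_dim R \<mm> (odd_part R)"
    using distinct_card[OF bs(2)] bs(1) B(3) by simp
  ultimately show ?thesis using that by blast
qed

text \<open>Since \<open>(\<mm>/\<mm>\<^sup>2)\<^sub>1 = R\<^sub>1 / \<nn> R\<^sub>1\<close>, Nakayama's lemma turns a basis into generators of the odd part.\<close>

lemma odd_cotangent_basis_generates:
  assumes zs: "odd_cotangent_basis R \<mm> zs"
  shows "set zs \<subseteq> odd_part R" "odd_part R \<subseteq> even_span R (set zs)"
proof -
  interpret V: vectorspace "R Quot \<mm>" "cotangent_space (odd_part R)"
    by (rule cotangent_vectorspace[OF even_submodule_odd])
  have zs': "set zs \<subseteq> \<mm> \<inter> odd_part R" "V.span ((+>) \<mm>\<^sup>2 ` set zs) = carrier (cotangent_space (odd_part R))"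
    using zs unfolding odd_cotangent_basis_def Let_def V.basis_def by simp_all
  show sub: "set zs \<subseteq> odd_part R" using zs'(1) by blast
  then have subR: "set zs \<subseteq> carrier R" by auto
  show "odd_part R \<subseteq> even_span R (set zs)"
  proof (rule nakayama[OF disjI2[OF refl] order_refl even_submodule_span[OF subR]
        even_span_minimal[OF even_submodule_odd sub]])
    fix K assume K: "even_submodule R K" "K \<subseteq> odd_part R" "even_span R (set zs) \<subseteq> K"
      and step: "\<And>a x. a \<in> \<nn> \<Longrightarrow> x \<in> odd_part R \<Longrightarrow> a \<otimes> x \<in> K"
    have sq: "\<mm>\<^sup>2 \<inter> odd_part R \<subseteq> K" by (rule msq_odd_minimal[OF K(1,2) step])
    have S: "set zs \<subseteq> K" using K(3) even_span_superset[of "set zs"] by blast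
    show "odd_part R \<subseteq> K"
    proof
      fix x assume "x \<in> odd_part R"
      then have x: "x \<in> \<mm> \<inter> odd_part R" using odd_in_m by blast
      then have "\<mm>\<^sup>2 +> x \<in> V.span ((+>) \<mm>\<^sup>2 ` set zs)" unfolding zs'(2) cotangent_simps by (rule imageI)
      then show "x \<in> K" using span_cosetD[OF even_submodule_odd K(1) S sq zs'(1) K(2) x] by blast
    qed
  qed
qed

text \<open>Since \<open>(\<mm>/\<mm>\<^sup>2)\<^sub>0 = \<nn> / (\<nn>\<^sup>2 + \<jj>)\<close>, a basis vector lifts to an element \<open>t\<close> with
\<open>\<nn> = R\<^sub>0 t + \<jj>\<close>, again by Nakayama's lemma.\<close>

lemma reduced_uniformizer_exists:
  assumes "cotangent_dim R \<mm> (even_part R) = 1"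
  shows "\<exists>t. reduced_uniformizer t"
proof -
  interpret V: vectorspace "R Quot \<mm>" "cotangent_space (even_part R)"
    by (rule cotangent_vectorspace[OF even_submodule_even])
  obtain B where B: "V.basis B" "card B = 1"
    using cotangent_basis[of "even_part R"] assms by metis
  obtain b where "B = {b}" using B(2) card_1_singletonE by blast
  then have b: "V.span {b} = carrier (cotangent_space (even_part R))" "b \<in> carrier (cotangent_space (even_part R))"
    using B(1) unfolding V.basis_def by auto
  obtain t where t: "t \<in> \<nn>" "b = \<mm>\<^sup>2 +> t" using b(2) unfolding cotangent_simps by blast
  have te: "t \<in> even_part R" "t \<in> carrier R" using t(1) by auto
  define L where "L = {k \<oplus> a \<otimes> t | k a. k \<in> \<jj> \<and> a \<in> even_part R}"
  have L: "even_submodule R L" "\<jj> \<subseteq> L" "t \<in> L"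
    using even_submodule_adjoin[OF even_submodule_odd_ideal te(2)] by (simp_all add: L_def)
  have "L \<subseteq> even_part R" using te(1) by (auto simp: L_def)
  have "\<nn> \<subseteq> L"
  proof (rule nakayama[OF disjI1[OF refl] _ L(1) \<open>L \<subseteq> even_part R\<close>])
    fix K assume K: "even_submodule R K" "K \<subseteq> even_part R" "L \<subseteq> K"
      and step: "\<And>a x. a \<in> \<nn> \<Longrightarrow> x \<in> \<nn> \<Longrightarrow> a \<otimes> x \<in> K"
    have jK: "\<jj> \<subseteq> K" using L(2) K(3) by (rule subset_trans)
    have sq: "\<mm>\<^sup>2 \<inter> even_part R \<subseteq> K" by (rule msq_even_minimal[OF K(1,2) step jK])
    have S: "{t} \<subseteq> K" "{t} \<subseteq> \<nn>" using L(3) K(3) t(1) by auto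
    show "\<nn> \<subseteq> K"
    proof
      fix x assume x: "x \<in> \<nn>"
      then have "\<mm>\<^sup>2 +> x \<in> V.span ((+>) \<mm>\<^sup>2 ` {t})"
        unfolding image_insert image_empty t(2)[symmetric] b(1) cotangent_simps by (rule imageI)
      then show "x \<in> K" using span_cosetD[OF even_submodule_even K(1) S(1) sq S(2) K(2) x] by blast
    qed
  qed simp
  have "reduced_uniformizer t" unfolding reduced_uniformizer_def
  proof (intro conjI ballI t(1))
    fix x assume "x \<in> \<nn>"
    then obtain k a where k: "k \<in> \<jj>" "a \<in> even_part R" "x = k \<oplus> a \<otimes> t"
      using \<open>\<nn> \<subseteq> L\<close> unfolding L_def by blast
    then have "x = a \<otimes> t \<oplus> k" using j_closed(3)[OF k(1)] te by (simp add: a_comm)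
    then show "\<exists>a\<in>even_part R. \<exists>k\<in>\<jj>. x = a \<otimes> t \<oplus> k" using k(1,2) by blast
  qed
  then show ?thesis by blast
qed

text \<open>The class of \<open>t\<close> spans. If the space were zero, then \<open>\<nn> = \<nn>\<^sup>2 + \<jj>\<close> and \<open>\<nn> = \<jj>\<close> by Nakayama's
lemma.\<close>

lemma cotangent_dim_even_eq_1:
  assumes t: "reduced_uniformizer t" and ne: "\<jj> \<noteq> \<nn>"
  shows "cotangent_dim R \<mm> (even_part R) = 1"
proof -
  interpret V: vectorspace "R Quot \<mm>" "cotangent_space (even_part R)"
    by (rule cotangent_vectorspace[OF even_submodule_even])
  have tn: "t \<in> \<nn>" using t by (simp add: reduced_uniformizer_def)
  define N where "N = {x \<in> \<nn>. \<mm>\<^sup>2 +> x \<in> V.span ((+>) \<mm>\<^sup>2 ` {t})}"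
  have N: "even_submodule R N" "{t} \<subseteq> N" "\<mm>\<^sup>2 \<inter> even_part R \<subseteq> N"
    using span_vimage[OF even_submodule_even, of "{t}"] tn unfolding N_def by simp_all
  have "\<nn> \<subseteq> N"
  proof
    fix x assume "x \<in> \<nn>"
    then obtain a k where a: "a \<in> even_part R" "k \<in> \<jj>" "x = a \<otimes> t \<oplus> k"
      using t unfolding reduced_uniformizer_def by blast
    have "a \<otimes> t \<in> N" using even_submodule_closed(5)[OF N(1) a(1)] N(2) by simp
    moreover have "k \<in> N" using a(2) odd_ideal_in_msq N(3) by blast
    ultimately show "x \<in> N" unfolding a(3) by (rule even_submodule_closed(2)[OF N(1)])
  qed
  let ?A = "{\<mm>\<^sup>2 +> t}"
  have A: "?A \<subseteq> carrier (cotangent_space (even_part R))" unfolding cotangent_simps using tn by blast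
  have "carrier (cotangent_space (even_part R)) \<subseteq> V.span ?A"
    unfolding cotangent_simps using \<open>\<nn> \<subseteq> N\<close> by (auto simp: N_def)
  then have "V.gen_set ?A" using V.span_is_subset2[OF A] by blast
  then have "V.dim \<le> 1" using V.gen_ge_dim[OF _ A] by simp
  moreover have "V.dim \<noteq> 0"
  proof
    assume 0: "V.dim = 0"
    obtain B where B: "finite B" "V.basis B" "card B = cotangent_dim R \<mm> (even_part R)"
      using cotangent_basis[of "even_part R"] by blast
    then have "B = {}" using 0 by (simp add: cotangent_dim_def)
    then have span: "V.span ((+>) \<mm>\<^sup>2 ` {}) = carrier (cotangent_space (even_part R))"
      using B(2) unfolding V.basis_def by simp
    have "\<nn> \<subseteq> \<jj>"
    proof (rule nakayama[OF disjI1[OF refl] _ even_submodule_odd_ideal])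
      fix K assume K: "even_submodule R K" "K \<subseteq> even_part R" "\<jj> \<subseteq> K"
        and step: "\<And>a x. a \<in> \<nn> \<Longrightarrow> x \<in> \<nn> \<Longrightarrow> a \<otimes> x \<in> K"
      have sq: "\<mm>\<^sup>2 \<inter> even_part R \<subseteq> K" by (rule msq_even_minimal[OF K(1,2) step K(3)])
      show "\<nn> \<subseteq> K"
      proof
        fix x assume x: "x \<in> \<nn>"
        then have "\<mm>\<^sup>2 +> x \<in> V.span ((+>) \<mm>\<^sup>2 ` {})" unfolding span cotangent_simps by (rule imageI)
        then show "x \<in> K"
          using span_cosetD[OF even_submodule_even K(1) empty_subsetI sq empty_subsetI K(2) x] by blast
      qed
    qed auto
    then show False using ne j_subset_n by blast
  qed
  ultimately show ?thesis by (simp add: cotangent_dim_def)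
qed

end

section \<open>Odd parameters and discrete valuation superrings\<close>

context noetherian_local_superring
begin

text \<open>The even part \<open>a\<close> of a regular element \<open>c = a + b\<close> is regular: if \<open>a r = 0\<close>, then
\<open>c (b r) = b (a r) + b\<^sup>2 r = 0\<close>, so \<open>b r = 0\<close>, then \<open>c r = 0\<close>, and \<open>r = 0\<close>.\<close>

lemma regular_even_element:
  assumes "regular_ideal \<mm> R"
  obtains a where "a \<in> \<nn>" "\<And>r. r \<in> even_part R \<union> odd_part R \<Longrightarrow> a \<otimes> r = \<zero> \<Longrightarrow> r = \<zero>"
proof -
  obtain c where c: "c \<in> \<mm>" "non_zerodivisor R c" using assms unfolding regular_ideal_def by blast
  have reg: "r = \<zero>" if "r \<in> even_part R \<union> odd_part R" "c \<otimes> r = \<zero>" for r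
    using c(2) that unfolding non_zerodivisor_def zerodivisor_def homogeneous_def by blast
  obtain a b where ab: "a \<in> \<nn>" "b \<in> odd_part R" "c = a \<oplus> b" using m_decompose[OF c(1)] by blast
  have carr: "a \<in> carrier R" "b \<in> carrier R" using ab by auto
  have "r = \<zero>" if r: "r \<in> even_part R \<union> odd_part R" and 0: "a \<otimes> r = \<zero>" for r
  proof -
    have rc: "r \<in> carrier R" using r by auto
    have "b \<otimes> r \<in> even_part R \<union> odd_part R" using r ab(2) by auto
    moreover have "c \<otimes> (b \<otimes> r) = \<zero>"
    proof -
      have "c \<otimes> (b \<otimes> r) = a \<otimes> (b \<otimes> r) \<oplus> (b \<otimes> b) \<otimes> r"
        unfolding ab(3) using carr rc by algebra
      also have "a \<otimes> (b \<otimes> r) = b \<otimes> (a \<otimes> r)" using even_left_commute[of a b r] ab(1) carr(2) rc by simp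
      also have "b \<otimes> b = \<zero>" using odd_square[OF ab(2)] .
      finally show ?thesis using 0 carr rc by simp
    qed
    ultimately have "b \<otimes> r = \<zero>" by (rule reg)
    then have "c \<otimes> r = \<zero>" unfolding ab(3) using 0 carr rc by (simp add: l_distr)
    then show "r = \<zero>" by (rule reg[OF r])
  qed
  then show ?thesis using that ab(1) by blast
qed

lemma even_annihilator_submodule:
  assumes "z \<in> carrier R" shows "even_submodule R (even_annihilator R z)"
  unfolding even_annihilator_def
  by (rule even_submoduleI) (use assms in \<open>auto simp: l_distr m_assoc\<close>)

text \<open>This is where the regularity of \<open>\<mm>\<close> enters. A regular even element of \<open>\<mm>\<close> has the form
\<open>a = b t + k\<close> with \<open>k \<in> \<jj>\<close>, and \<open>k z = 0\<close>. So \<open>y t z = 0\<close> implies \<open>a y z = 0\<close> and \<open>y z = 0\<close>: the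
annihilator \<open>A\<close> of \<open>z\<close> satisfies \<open>A \<subseteq> t A + \<jj>\<close>.\<close>

lemma even_annihilator_subset_j:
  assumes t: "reduced_uniformizer t"
    and reg: "a \<in> \<nn>" "\<And>r. r \<in> even_part R \<union> odd_part R \<Longrightarrow> a \<otimes> r = \<zero> \<Longrightarrow> r = \<zero>"
    and z: "z \<in> even_part R \<union> odd_part R" "z \<noteq> \<zero>"
    and jz: "\<And>k. k \<in> \<jj> \<Longrightarrow> k \<otimes> z = \<zero>"
  shows "even_annihilator R z \<subseteq> \<jj>"
proof -
  let ?A = "even_annihilator R z"
  have zc: "z \<in> carrier R" using z(1) by auto
  have sub: "?A \<subseteq> even_part R" by (auto simp: even_annihilator_def)
  note A = even_annihilator_submodule[OF zc]
  have "\<one> \<notin> ?A" using z(2) zc by (simp add: even_annihilator_def)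
  then have An: "?A \<subseteq> \<nn>" by (rule even_submodule_proper[OF A sub])
  have jA: "\<jj> \<subseteq> ?A" using jz by (auto simp: even_annihilator_def)
  have tn: "t \<in> \<nn>" "t \<in> even_part R" "t \<in> carrier R" using t by (auto simp: reduced_uniformizer_def)
  obtain b k where b: "b \<in> even_part R" "k \<in> \<jj>" "a = b \<otimes> t \<oplus> k"
    using t reg(1) unfolding reduced_uniformizer_def by blast
  have bc: "b \<in> carrier R" "k \<in> carrier R" using b(1) j_closed(3)[OF b(2)] by auto
  show ?thesis
  proof (rule divisible_subset_j[OF sub tn(1)])
    fix x assume x: "x \<in> ?A"
    then obtain y l where y: "y \<in> even_part R" "l \<in> \<jj>" "x = y \<otimes> t \<oplus> l" "y \<otimes> t \<in> ?A"
      using uniformizer_multiple[OF t A jA x] An by blast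
    have yc: "y \<in> carrier R" using y(1) by simp
    have "a \<otimes> (y \<otimes> z) = b \<otimes> (t \<otimes> y \<otimes> z) \<oplus> k \<otimes> y \<otimes> z"
      unfolding b(3) using bc yc tn(3) zc by algebra
    also have "t \<otimes> y \<otimes> z = \<zero>"
      using y(4) even_central[OF tn(2) yc] by (simp add: even_annihilator_def)
    also have "k \<otimes> y = y \<otimes> k" using even_central[OF y(1) bc(2)] by simp
    also have "y \<otimes> k \<otimes> z = \<zero>" using jz[OF j_closed(2)[OF y(1) b(2)]] .
    finally have "a \<otimes> (y \<otimes> z) = \<zero>" using bc by simp
    moreover have "y \<otimes> z \<in> even_part R \<union> odd_part R" using y(1) z(1) by auto
    ultimately have "y \<otimes> z = \<zero>" using reg(2) by blast
    then have "y \<in> ?A" using y(1) by (simp add: even_annihilator_def)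
    then show "\<exists>y\<in>?A. \<exists>k\<in>\<jj>. x = y \<otimes> t \<oplus> k" using y(2,3) by blast
  qed
qed

lemma odd_parameters_nonzero:
  assumes K: "Kdim (even_ring R) = 1" and as: "odd_parameters R as"
  shows "super_prod R as \<noteq> \<zero>"
proof
  assume "super_prod R as = \<zero>"
  then have "even_annihilator R (super_prod R as) = carrier (even_ring R)"
    by (auto simp: even_annihilator_def)
  then show False
    using as K cring.Kdim_quotient_carrier[OF even_ring_cring] unfolding odd_parameters_def by simp
qed

lemma odd_parameters_length:
  assumes K: "Kdim (even_ring R) = 1" and zs: "odd_cotangent_basis R \<mm> zs"
    and as: "odd_parameters R as"
  shows "length as \<le> length zs"
proof (rule ccontr)
  assume "\<not> length as \<le> length zs"
  moreover have "set as \<subseteq> odd_part R" using as by (simp add: odd_parameters_def)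
  ultimately have "super_prod R as = \<zero>"
    using super_prod_long[OF odd_cotangent_basis_generates[OF zs]] by simp
  then show False using odd_parameters_nonzero[OF K as] by simp
qed

text \<open>All primes of the even part contain \<open>\<jj>\<close>, so factoring out an annihilator inside \<open>\<jj>\<close> preserves the
dimension.\<close>

lemma odd_parametersI:
  assumes K: "Kdim (even_ring R) = 1" and as: "set as \<subseteq> odd_part R"
    and sub: "even_annihilator R (super_prod R as) \<subseteq> \<jj>"
  shows "odd_parameters R as"
proof -
  let ?A = "even_annihilator R (super_prod R as)"
  have "ideal ?A (even_ring R)"
    using even_annihilator_submodule[of "super_prod R as"] as
    unfolding ideal_even_ring_iff by (auto simp: even_annihilator_def)
  moreover have "?A \<subseteq> P" if "primeideal P (even_ring R)" for P
    using sub odd_ideal_subset_prime[OF that] by (rule subset_trans)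
  ultimately have "Kdim (even_ring R Quot ?A) = 1"
    using cring.Kdim_quotient_eq_1[OF even_ring_cring] K by blast
  then show ?thesis using K as by (simp add: odd_parameters_def)
qed

lemma local_superring_unique: "local_superring R \<mm>' \<Longrightarrow> \<mm>' = \<mm>"
  using local_ring by (auto simp: local_superring_def)

lemma discrete_valuation_superring_iff:
  "discrete_valuation_superring R \<longleftrightarrow> Kdim (even_ring R) = 1 \<and>
    cotangent_dim R \<mm> (even_part R) = 1 \<and> Ksdim1 R = enat (cotangent_dim R \<mm> (odd_part R))"
proof
  assume D: "discrete_valuation_superring R"
  then obtain N where N: "Ksdim R = (1, enat N)" unfolding discrete_valuation_superring_def by blast
  obtain \<mm>' where m': "local_superring R \<mm>'" "Ksdim R = (ereal (real (cotangent_dim R \<mm>' (even_part R))),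
      enat (cotangent_dim R \<mm>' (odd_part R)))"
    using D unfolding discrete_valuation_superring_def regular_superring_def by blast
  have "\<mm>' = \<mm>" using local_superring_unique[OF m'(1)] .
  then show "Kdim (even_ring R) = 1 \<and> cotangent_dim R \<mm> (even_part R) = 1 \<and>
      Ksdim1 R = enat (cotangent_dim R \<mm> (odd_part R))"
    using N m'(2) by (simp add: Ksdim_def Ksdim0_def one_ereal_def)
next
  assume "Kdim (even_ring R) = 1 \<and> cotangent_dim R \<mm> (even_part R) = 1 \<and>
      Ksdim1 R = enat (cotangent_dim R \<mm> (odd_part R))"
  then show "discrete_valuation_superring R"
    using noetherian local_ring
    unfolding discrete_valuation_superring_def regular_superring_def
    by (auto simp: Ksdim_def Ksdim0_def one_ereal_def)
qed

lemma dvsr_imp_dvr_reduction: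
  assumes "discrete_valuation_superring R"
  shows "discrete_valuation_ring (super_reduction R)"
proof -
  have D: "Kdim (even_ring R) = 1" "cotangent_dim R \<mm> (even_part R) = 1"
    using assms discrete_valuation_superring_iff by blast+
  obtain t where t: "reduced_uniformizer t" using reduced_uniformizer_exists[OF D(2)] by blast
  show ?thesis using dvr_reductionI[OF _ _ t] Kdim_even_ring_eq_1_iff[OF t] D(1) by blast
qed

text \<open>The odd Krull superdimension is \<open>s\<close>, so some \<open>s\<close> odd elements form a system of parameters and have a
nonzero product; this is impossible if the product of \<open>s\<close> generators vanishes.\<close>

lemma dvsr_imp_prod_nonzero:
  assumes D: "discrete_valuation_superring R" and zs: "odd_cotangent_basis R \<mm> zs"
    and len: "length zs = cotangent_dim R \<mm> (odd_part R)"
  shows "super_prod R zs \<noteq> \<zero>"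
proof
  assume zero: "super_prod R zs = \<zero>"
  have K: "Kdim (even_ring R) = 1" and K1: "Ksdim1 R = enat (length zs)"
    using D discrete_valuation_superring_iff len by auto
  have nz: "length zs \<noteq> 0" using zero one_not_zero by auto
  have "length as < length zs" if as: "odd_parameters R as" for as
  proof -
    have "length as \<noteq> length zs"
      using super_prod_eq_zero[OF odd_cotangent_basis_generates[OF zs] _ _ zero, of as] as
        odd_parameters_nonzero[OF K as] by (auto simp: odd_parameters_def)
    then show ?thesis using odd_parameters_length[OF K zs as] by simp
  qed
  then have "Ksdim1 R \<le> enat (length zs - 1)"
    unfolding Ksdim1_def by (intro SUP_least) (fastforce simp: nat_less_le)
  then show False using K1 nz by (cases zs) auto
qed

lemma dvsrI:
  assumes reg: "regular_ideal \<mm> R" and dvr: "discrete_valuation_ring (super_reduction R)"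
    and zs: "odd_cotangent_basis R \<mm> zs" "length zs = cotangent_dim R \<mm> (odd_part R)"
    and nz: "super_prod R zs \<noteq> \<zero>"
  shows "discrete_valuation_superring R"
proof -
  note D = dvr_reductionD[OF dvr] and Z = odd_cotangent_basis_generates[OF zs(1)]
  obtain t where t: "reduced_uniformizer t" using D(3) by blast
  have K: "Kdim (even_ring R) = 1" using Kdim_even_ring_eq_1_iff[OF t] D(1,2) by blast
  obtain a where a: "a \<in> \<nn>" "\<And>r. r \<in> even_part R \<union> odd_part R \<Longrightarrow> a \<otimes> r = \<zero> \<Longrightarrow> r = \<zero>"
    using regular_even_element[OF reg] by blast
  have "super_prod R zs \<in> even_part R \<union> odd_part R" using super_prod_homogeneous[OF Z(1)] by blast
  then have "even_annihilator R (super_prod R zs) \<subseteq> \<jj>"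
    using even_annihilator_subset_j[OF t a _ nz odd_ideal_annihilates_prod[OF Z]] by blast
  then have par: "odd_parameters R zs" by (rule odd_parametersI[OF K Z(1)])
  have "Ksdim1 R = enat (length zs)"
    unfolding Ksdim1_def
  proof (rule antisym)
    show "(SUP as\<in>{as. odd_parameters R as}. enat (length as)) \<le> enat (length zs)"
      using odd_parameters_length[OF K zs(1)] by (intro SUP_least) simp
    show "enat (length zs) \<le> (SUP as\<in>{as. odd_parameters R as}. enat (length as))"
      using par by (intro SUP_upper) simp
  qed
  then show ?thesis
    unfolding discrete_valuation_superring_iff
    using K cotangent_dim_even_eq_1[OF t D(2)] zs(2) by simp
qed

end

theorem theorem5p10:
  fixes R :: "('a, 'b) superring_scheme" and \<mm> :: "'a set" and s :: nat
  assumes "superring R"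
    and "noetherian_superring R"
    and "local_superring R \<mm>"
    and "regular_ideal \<mm> R"
    and "s = cotangent_dim R \<mm> (odd_part R)"
  shows
    "(discrete_valuation_superring R \<longleftrightarrow>
        discrete_valuation_ring (super_reduction R) \<and>
        (\<forall>zs. length zs = s \<and> odd_cotangent_basis R \<mm> zs \<longrightarrow> super_prod R zs \<noteq> \<zero>\<^bsub>R\<^esub>)) \<and>
     (discrete_valuation_superring R \<longleftrightarrow>
        discrete_valuation_ring (super_reduction R) \<and>
        (\<exists>zs. length zs = s \<and> odd_cotangent_basis R \<mm> zs \<and> super_prod R zs \<noteq> \<zero>\<^bsub>R\<^esub>))"
proof -
  interpret noetherian_local_superring R \<mm>
    using assms by (intro noetherian_local_superring.intro noetherian_local_superring_axioms.intro)
  obtain zs where zs: "length zs = s" "odd_cotangent_basis R \<mm> zs"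
    using odd_cotangent_basis_exists unfolding assms(5) by blast
  show ?thesis
    using zs dvsr_imp_dvr_reduction dvsr_imp_prod_nonzero dvsrI[OF assms(4)]
    unfolding assms(5) by metis
qed

end
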